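(* Let $J_C:CR^1_0(\mathcal T)\to S^1_0(\mathcal T)$ be any map such that for every $v_{CR}\in CR^1_0(\mathcal T)$ and every interior node $z\in\mathcal N(\Omega)$, $$J_Cv_{CR}(z)\in\operatorname{conv}\{v_{CR}|_T(z):\ T\in\mathcal T(z)\}.$$ Let $c_{apx}^2:=\frac{\sqrt3}{2}\cot(\omega_0)/(1-\cos(\pi/M_{patch}))$. Then every $v_{CR}\in CR^1_0(\mathcal T)$ satisfies $$\|h_{\mathcal T}^{-1}(v_{CR}-J_Cv_{CR})\|_{L^2(\Omega)}\le c_{apx}\|\nabla_{NC}v_{CR}\|_{L^2(\Omega)}$$ and, for every $T\in\mathcal T$, $$\|h_T^{-1}(v_{CR}-J_Cv_{CR})\|_{L^2(T)}\le c_{apx}\|\nabla_{NC}v_{CR}\|_{L^2(\omega_T)}.$$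
   Context: $\Omega\subset\mathbb R^2$ is a bounded polygonal Lipschitz domain and $\mathcal T$ a regular triangulation of $\Omega$ into triangles; $\omega_0>0$ is a lower bound for all interior angles of triangles in $\mathcal T$. $\mathcal N$, $\mathcal N(\Omega)$, $\mathcal N(\partial\Omega)$ denote all / interior / boundary vertices; $\mathcal T(z)=\{T\in\mathcal T: z\text{ vertex of }T\}$, $\omega_z=\bigcup\mathcal T(z)$, $\omega_T=\bigcup_{z\text{ vertex of }T}\omega_z$. $M_{int}=\max_{z\in\mathcal N(\Omega)}|\mathcal T(z)|$, $M_{bd}=\max_{z\in\mathcal N(\partial\Omega)}|\mathcal T(z)|$, $M_{patch}=\max\{M_{int},M_{bd}\}$. $h_T=\operatorname{diam}(T)$ and $h_{\mathcal T}|_T=h_T$. $S^1_0(\mathcal T)$ is the space of continuous piecewise affine functions vanishing on $\partial\Omega$; $CR^1_0(\mathcal T)$ is the Crouzeix–Raviart space of piecewise affine functions continuous at the midpoints of interior edges and vanishing at midpoints of boundary edges; $\nabla_{NC}$ is the piecewise gradient. *)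

theory Defs
  imports "HOL-Analysis.Analysis"
begin

type_synonym pt = "real^2"

definition lipschitz_domain :: "pt set \<Rightarrow> bool" where
  "lipschitz_domain \<Omega> \<longleftrightarrow> \<Omega> \<noteq> {} \<and> open \<Omega> \<and> connected \<Omega> \<and> bounded \<Omega> \<and>
     (\<forall>p\<in>frontier \<Omega>. \<exists>r>0. \<exists>(R::pt \<Rightarrow> pt) (g::real \<Rightarrow> real) L.
        orthogonal_transformation R \<and> (\<forall>s t. \<bar>g s - g t\<bar> \<le> L * \<bar>s - t\<bar>) \<and>
        (\<forall>x\<in>ball p r. x \<in> \<Omega> \<longleftrightarrow> (R x) $ 2 < g ((R x) $ 1)))"

text \<open>A triangle is given by its set of three affinely independent vertices; the closed
  triangle is its convex hull.\<close>
definition is_triangle :: "pt set \<Rightarrow> bool" where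
  "is_triangle T \<longleftrightarrow> card T = 3 \<and> \<not> affine_dependent T"

definition regular_triangulation :: "pt set \<Rightarrow> pt set set \<Rightarrow> bool" where
  "regular_triangulation \<Omega> \<T> \<longleftrightarrow> finite \<T> \<and> \<T> \<noteq> {} \<and> (\<forall>T\<in>\<T>. is_triangle T) \<and>
     \<Union> ((\<lambda>T. convex hull T) ` \<T>) = closure \<Omega> \<and>
     (\<forall>T\<in>\<T>. \<forall>T'\<in>\<T>. T \<noteq> T' \<longrightarrow> convex hull T \<inter> convex hull T' = convex hull (T \<inter> T'))"

definition vangle :: "pt \<Rightarrow> pt \<Rightarrow> real" where
  "vangle u w = arccos ((u \<bullet> w) / (norm u * norm w))"

definition min_angle_bound :: "pt set set \<Rightarrow> real \<Rightarrow> bool" where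
  "min_angle_bound \<T> \<omega>0 \<longleftrightarrow> (\<forall>T\<in>\<T>. \<forall>a\<in>T. \<forall>b\<in>T. \<forall>c\<in>T.
      a \<noteq> b \<and> a \<noteq> c \<and> b \<noteq> c \<longrightarrow> \<omega>0 \<le> vangle (b - a) (c - a))"

definition nodes :: "pt set set \<Rightarrow> pt set" where
  "nodes \<T> = \<Union> \<T>"

definition tri_at :: "pt set set \<Rightarrow> pt \<Rightarrow> pt set set" where
  "tri_at \<T> z = {T\<in>\<T>. z \<in> T}"

definition M_patch :: "pt set set \<Rightarrow> nat" where
  "M_patch \<T> = Max ((\<lambda>z. card (tri_at \<T> z)) ` nodes \<T>)"

definition node_patch :: "pt set set \<Rightarrow> pt \<Rightarrow> pt set" where
  "node_patch \<T> z = \<Union> ((\<lambda>T. convex hull T) ` tri_at \<T> z)"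

definition elem_patch :: "pt set set \<Rightarrow> pt set \<Rightarrow> pt set" where
  "elem_patch \<T> T = (\<Union>z\<in>T. node_patch \<T> z)"

definition affine_fun :: "(pt \<Rightarrow> real) \<Rightarrow> bool" where
  "affine_fun f \<longleftrightarrow> (\<exists>b c. \<forall>x. f x = b \<bullet> x + c)"

definition agrad :: "(pt \<Rightarrow> real) \<Rightarrow> pt" where
  "agrad f = (SOME b. \<exists>c. \<forall>x. f x = b \<bullet> x + c)"

definition S10 :: "pt set \<Rightarrow> pt set set \<Rightarrow> (pt \<Rightarrow> real) set" where
  "S10 \<Omega> \<T> = {u. continuous_on (closure \<Omega>) u \<and>
      (\<forall>T\<in>\<T>. \<exists>g. affine_fun g \<and> (\<forall>x\<in>convex hull T. u x = g x)) \<and>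
      (\<forall>x\<in>frontier \<Omega>. u x = 0)}"

text \<open>Crouzeix-Raviart functions, represented by the family of affine pieces v T on T\<in>\<T>.\<close>
definition CR10 :: "pt set \<Rightarrow> pt set set \<Rightarrow> (pt set \<Rightarrow> pt \<Rightarrow> real) set" where
  "CR10 \<Omega> \<T> = {v. (\<forall>T\<in>\<T>. affine_fun (v T)) \<and>
      (\<forall>T\<in>\<T>. \<forall>T'\<in>\<T>. \<forall>a b. a \<noteq> b \<and> {a, b} \<subseteq> T \<and> {a, b} \<subseteq> T' \<and> midpoint a b \<in> \<Omega>
          \<longrightarrow> v T (midpoint a b) = v T' (midpoint a b)) \<and>
      (\<forall>T\<in>\<T>. \<forall>a b. a \<noteq> b \<and> {a, b} \<subseteq> T \<and> midpoint a b \<in> frontier \<Omega>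
          \<longrightarrow> v T (midpoint a b) = 0)}"

definition hT :: "pt set \<Rightarrow> real" where
  "hT T = diameter (convex hull T)"

end

theory Submission
  imports Defs
begin

text \<open>
  The proof reduces the error to the vertices. By convexity, the integral over a triangle \<open>T\<close> of the
  square of an affine function is at most \<open>|T|/3\<close> times the sum of its squared vertex values, and
  \<open>|T| \<le> \<surd>3/4 h\<^sub>T\<^sup>2\<close>. At a node \<open>z\<close>, continuity at the edge midpoints expresses the jumps of the values
  \<open>v\<^sub>T(z)\<close> between neighbouring triangles by tangential derivatives. The triangles at an interior node
  form a cycle, and an intermediate value of the \<open>v\<^sub>T(z)\<close> cuts it into two discrete Dirichlet problems;
  at a boundary node they form paths, with a homogeneous condition half a step beyond either end. The
  least eigenvalue is in both cases at least \<open>2 (1 - cos (\<pi>/n))\<close>, where \<open>n\<close> is the number of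
  triangles. Finally the squared side lengths of a triangle add up to \<open>4 |T|\<close> times the sum of
  the cotangents of its angles.

  The Lipschitz property enters only through \<open>interior (closure \<Omega>) \<subseteq> \<Omega>\<close>.
\<close>

subsection \<open>Discrete Dirichlet inequalities\<close>

text \<open>At a node, let y be the values \<open>v T z - u z\<close> and d half the increment of
  \<open>v T\<close> from the node along an edge, so that y + d is the midpoint value up to a common
  shift. Across an inner edge y' - y = d - d', whose square is at most 2 d^2 + 2 d'^2; at a boundary
  edge y = - d, so 2 y^2 costs 2 d^2. Doubled end terms, the form of a zero half a step out, thus
  charge every pair of triangle and edge alike. A path of n values with such ends and a Dirichlet
  path of n - 1 values have the same least eigenvalue, so boundary nodes and cut cycles share one
  constant. The constants are sqrt 3 / 12 from the element error, 1 / (4 \<kappa>) with \<kappa> = 1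
  - cos (\<pi> / M) from a node, and 24 cot \<omega> from the sides of a triangle; their product is
  sqrt 3 / 2 * cot \<omega> / \<kappa>.

  The order of the triangles around a node is not part of the data. It is recovered from a link
  graph of degree at most two, and connectedness of a punctured disc shows that a cycle in the link
  exhausts the star.\<close>

lemma two_cos_mult_sin:
  fixes \<alpha> \<theta> :: real
  shows "sin (\<alpha> + \<theta>) + sin (\<alpha> - \<theta>) = 2 * cos \<theta> * sin \<alpha>"
  by (simp add: sin_add sin_diff algebra_simps)

text \<open>Picone's inequality on a single edge. Equality holds when a : b = s : t, so nothing is
  lost for data proportional to the comparison function.\<close>

lemma picone_sq_diff:
  fixes a b s t :: real
  assumes "s > 0" "t > 0"
  shows "(1 - s / t) * b\<^sup>2 + (1 - t / s) * a\<^sup>2 \<le> (b - a)\<^sup>2"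
proof -
  have "(b - a)\<^sup>2 - ((1 - s / t) * b\<^sup>2 + (1 - t / s) * a\<^sup>2) = (s * b - t * a)\<^sup>2 / (s * t)"
    using assms by (simp add: field_simps power2_eq_square)
  also have "\<dots> \<ge> 0"
    using assms by simp
  finally show ?thesis by simp
qed

text \<open>The sine is a positive solution of the three-term recurrence of the discrete Laplacian;
  comparing \<^term>\<open>y\<close> with it edge by edge telescopes into a lower bound for the Dirichlet sum.\<close>
lemma discrete_picone:
  fixes y :: "nat \<Rightarrow> real" and \<alpha> \<theta> :: real
  assumes "\<And>i. i \<le> m \<Longrightarrow> sin (\<alpha> + real i * \<theta>) > 0"
  shows "2 * (1 - cos \<theta>) * (\<Sum>i\<le>m. (y i)\<^sup>2)
     \<le> (1 - sin (\<alpha> - \<theta>) / sin \<alpha>) * (y 0)\<^sup>2 + (\<Sum>i<m. (y (Suc i) - y i)\<^sup>2)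
       + (1 - sin (\<alpha> + real (Suc m) * \<theta>) / sin (\<alpha> + real m * \<theta>)) * (y m)\<^sup>2"
  using assms
proof (induction m)
  case 0
  have "sin \<alpha> > 0" using 0[of 0] by simp
  then have "(sin (\<alpha> + \<theta>) + sin (\<alpha> - \<theta>)) / sin \<alpha> = 2 * cos \<theta>"
    by (simp add: two_cos_mult_sin)
  then have "2 * (1 - cos \<theta>) = (1 - sin (\<alpha> - \<theta>) / sin \<alpha>) + (1 - sin (\<alpha> + \<theta>) / sin \<alpha>)"
    by (simp add: add_divide_distrib)
  then have "2 * (1 - cos \<theta>) * (y 0)\<^sup>2
    = (1 - sin (\<alpha> - \<theta>) / sin \<alpha>) * (y 0)\<^sup>2 + (1 - sin (\<alpha> + \<theta>) / sin \<alpha>) * (y 0)\<^sup>2"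
    by (simp only: distrib_right)
  then show ?case by simp
next
  case (Suc m)
  define s where "s = (\<lambda>i. sin (\<alpha> + real i * \<theta>))"
  have pos: "s m > 0" "s (Suc m) > 0"
    unfolding s_def by (rule Suc.prems, simp)+
  have "s (Suc (Suc m)) + s m = 2 * cos \<theta> * s (Suc m)"
  proof -
    have "\<alpha> + real (Suc (Suc m)) * \<theta> = (\<alpha> + real (Suc m) * \<theta>) + \<theta>"
      "\<alpha> + real m * \<theta> = (\<alpha> + real (Suc m) * \<theta>) - \<theta>"
      by (simp_all add: algebra_simps)
    then show ?thesis unfolding s_def by (simp only: two_cos_mult_sin)
  qed
  then have "(s (Suc (Suc m)) + s m) / s (Suc m) = 2 * cos \<theta>"
    using pos by simp
  \<comment> \<open>The recurrence splits the weight of the new vertex into shares of its two edges.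
    The left share joins the old end term in Picone's inequality; the right share becomes the new
    end term.\<close>
  then have "2 * (1 - cos \<theta>) = (1 - s m / s (Suc m)) + (1 - s (Suc (Suc m)) / s (Suc m))"
    by (simp add: add_divide_distrib)
  then have "2 * (1 - cos \<theta>) * (y (Suc m))\<^sup>2
     = (1 - s m / s (Suc m)) * (y (Suc m))\<^sup>2 + (1 - s (Suc (Suc m)) / s (Suc m)) * (y (Suc m))\<^sup>2"
    by (simp only: distrib_right)
  moreover have "(1 - s m / s (Suc m)) * (y (Suc m))\<^sup>2 + (1 - s (Suc m) / s m) * (y m)\<^sup>2
     \<le> (y (Suc m) - y m)\<^sup>2"
    by (rule picone_sq_diff[OF pos])
  moreover have "2 * (1 - cos \<theta>) * (\<Sum>i\<le>m. (y i)\<^sup>2)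
     \<le> (1 - sin (\<alpha> - \<theta>) / sin \<alpha>) * (y 0)\<^sup>2 + (\<Sum>i<m. (y (Suc i) - y i)\<^sup>2)
       + (1 - s (Suc m) / s m) * (y m)\<^sup>2"
    unfolding s_def by (rule Suc.IH, rule Suc.prems) simp
  ultimately show ?case
    unfolding sum.atMost_Suc sum.lessThan_Suc distrib_left s_def by linarith
qed

text \<open>Zeros sit one full step outside the path. The sine of step \<pi> / N vanishes at the
  left one and, as m + 2 \<le> N, is nonnegative at the right one: a supersolution for every such N,
  which gives the bound for N directly.\<close>

lemma path_dirichlet_sum_ge:
  fixes y :: "nat \<Rightarrow> real"
  assumes "m + 2 \<le> N"
  shows "2 * (1 - cos (pi / real N)) * (\<Sum>i\<le>m. (y i)\<^sup>2)
     \<le> (y 0)\<^sup>2 + (\<Sum>i<m. (y (Suc i) - y i)\<^sup>2) + (y m)\<^sup>2"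
proof -
  define \<theta> where "\<theta> = pi / real N"
  have \<theta>: "\<theta> > 0" "real N * \<theta> = pi"
    using assms by (simp_all add: \<theta>_def)
  have le: "\<theta> + real i * \<theta> < pi" if "i \<le> m" for i
  proof -
    have "\<theta> + real i * \<theta> = real (Suc i) * \<theta>" by (simp add: algebra_simps)
    also have "\<dots> < real N * \<theta>" using that assms \<theta> by (intro mult_strict_right_mono) auto
    finally show ?thesis using \<theta> by simp
  qed
  have pos: "sin (\<theta> + real i * \<theta>) > 0" if "i \<le> m" for i
    using le[OF that] \<theta> by (intro sin_gt_zero) (auto intro: add_pos_nonneg)
  \<comment> \<open>A nonnegative sine at the outer right index makes the end coefficient at most
    1.\<close>
  have "\<theta> + real (Suc m) * \<theta> = real (m + 2) * \<theta>" by (simp add: algebra_simps)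
  also have "\<dots> \<le> real N * \<theta>" using assms \<theta> by (intro mult_right_mono) auto
  finally have "sin (\<theta> + real (Suc m) * \<theta>) \<ge> 0"
    using \<theta> by (intro sin_ge_zero) auto
  then have "(1 - sin (\<theta> + real (Suc m) * \<theta>) / sin (\<theta> + real m * \<theta>)) * (y m)\<^sup>2 \<le> 1 * (y m)\<^sup>2"
    using pos[of m] by (intro mult_right_mono) auto
  with discrete_picone[OF pos, of m y] show ?thesis
    by (simp add: \<theta>_def)
qed

text \<open>The doubled end terms correspond to a zero half a step outside the path, as after odd
  reflection; hence the sine is sampled at half-integers.\<close>
lemma path_half_step_dirichlet_sum_ge:
  fixes y :: "nat \<Rightarrow> real"
  assumes "m + 1 \<le> N"
  shows "2 * (1 - cos (pi / real N)) * (\<Sum>i\<le>m. (y i)\<^sup>2)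
     \<le> 2 * (y 0)\<^sup>2 + (\<Sum>i<m. (y (Suc i) - y i)\<^sup>2) + 2 * (y m)\<^sup>2"
proof -
  define \<theta> where "\<theta> = pi / real N"
  have \<theta>: "\<theta> > 0" "real N * \<theta> = pi"
    using assms by (simp_all add: \<theta>_def)
  have le: "real (Suc i) * \<theta> \<le> pi" if "i \<le> m" for i
  proof -
    have "real (Suc i) * \<theta> \<le> real N * \<theta>" using that assms \<theta> by (intro mult_right_mono) auto
    then show ?thesis using \<theta> by simp
  qed
  have pos: "sin (\<theta> / 2 + real i * \<theta>) > 0" if "i \<le> m" for i
  proof (rule sin_gt_zero)
    show "0 < \<theta> / 2 + real i * \<theta>" using \<theta> by (auto intro: add_pos_nonneg)
    have "\<theta> / 2 + real i * \<theta> < real (Suc i) * \<theta>" using \<theta> by (simp add: algebra_simps)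
    then show "\<theta> / 2 + real i * \<theta> < pi" using le[OF that] by simp
  qed
  have "\<theta> \<le> pi" using le[of 0] by simp
  \<comment> \<open>This product is the sum of the sines at the last index and one step beyond.
    Their quotient is therefore at least -1, and the end coefficient at most 2.\<close>
  then have "0 \<le> 2 * cos (\<theta> / 2) * sin (real (Suc m) * \<theta>)"
    using le[of m] \<theta> by (intro mult_nonneg_nonneg cos_ge_zero sin_ge_zero) auto
  also have "\<dots> = sin (\<theta> / 2 + real (Suc m) * \<theta>) + sin (\<theta> / 2 + real m * \<theta>)"
  proof -
    have "real (Suc m) * \<theta> - \<theta> / 2 = \<theta> / 2 + real m * \<theta>" by (simp add: algebra_simps)
    then show ?thesis
      using two_cos_mult_sin[of "real (Suc m) * \<theta>" "\<theta> / 2"] by (simp add: add.commute)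
  qed
  finally have "1 - sin (\<theta> / 2 + real (Suc m) * \<theta>) / sin (\<theta> / 2 + real m * \<theta>) \<le> 2"
    using pos[of m] by (simp add: field_simps)
  then have "(1 - sin (\<theta> / 2 + real (Suc m) * \<theta>) / sin (\<theta> / 2 + real m * \<theta>)) * (y m)\<^sup>2 \<le> 2 * (y m)\<^sup>2"
    by (intro mult_right_mono) auto
  moreover have "1 - sin (\<theta> / 2 - \<theta>) / sin (\<theta> / 2) = 2"
    using pos[of 0] sin_minus[of "\<theta> / 2"] by (simp add: field_simps)
  ultimately show ?thesis
    using discrete_picone[of m "\<theta> / 2" \<theta> y, OF pos] by (simp add: \<theta>_def)
qed

section \<open>Sign changes along closed chains\<close>

lemma sign_change_index:
  fixes y :: "nat \<Rightarrow> real"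
  assumes "i < j" "y i \<le> 0" "0 \<le> y j"
  shows "\<exists>k. i \<le> k \<and> k < j \<and> y k \<le> 0 \<and> 0 \<le> y (Suc k)"
proof -
  define k where "k = (LEAST l. i < l \<and> 0 \<le> y l)"
  have k: "i < k \<and> 0 \<le> y k"
    unfolding k_def by (rule LeastI[of _ j]) (use assms in auto)
  have "k \<le> j"
    unfolding k_def by (rule Least_le) (use assms in auto)
  have "y (k - 1) \<le> 0"
  proof (cases "k - 1 = i")
    case False
    then have "i < k - 1" using k by auto
    then show ?thesis
      using not_less_Least[of "k - 1" "\<lambda>l. i < l \<and> 0 \<le> y l"] k by (auto simp flip: k_def)
  qed (use assms in auto)
  then show ?thesis using k \<open>k \<le> j\<close> by (intro exI[of _ "k - 1"]) auto
qed

text \<open>An edge across a sign change pays for zero boundary values on both of its sides, which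
  is why a chain may be cut there.\<close>

lemma sq_diff_ge_of_opposite_signs:
  fixes a b :: real
  assumes "a * b \<le> 0"
  shows "a\<^sup>2 + b\<^sup>2 \<le> (b - a)\<^sup>2"
  using assms by (simp add: power2_diff algebra_simps)

text \<open>One cut is normalised to the closing edge from m to 0, the other lies after k. Neither
  arc is empty, so each has at most m entries and meets the length condition of the Dirichlet
  bound.\<close>

lemma cycle_sum_ge_aux:
  fixes y :: "nat \<Rightarrow> real"
  assumes "k < m" "Suc m \<le> N"
    and "y k * y (Suc k) \<le> 0" "y m * y 0 \<le> 0"
  shows "2 * (1 - cos (pi / real N)) * (\<Sum>i\<le>m. (y i)\<^sup>2)
     \<le> (\<Sum>i<m. (y (Suc i) - y i)\<^sup>2) + (y 0 - y m)\<^sup>2"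
proof -
  define z where "z = (\<lambda>i. y (i + Suc k))"
  define l where "l = m - Suc k"
  have m: "m = l + Suc k" using assms(1) by (simp add: l_def)
  have 1: "2 * (1 - cos (pi / real N)) * (\<Sum>i\<le>k. (y i)\<^sup>2)
     \<le> (y 0)\<^sup>2 + (\<Sum>i<k. (y (Suc i) - y i)\<^sup>2) + (y k)\<^sup>2"
    by (rule path_dirichlet_sum_ge) (use assms in auto)
  have 2: "2 * (1 - cos (pi / real N)) * (\<Sum>i\<le>l. (z i)\<^sup>2)
     \<le> (z 0)\<^sup>2 + (\<Sum>i<l. (z (Suc i) - z i)\<^sup>2) + (z l)\<^sup>2"
    by (rule path_dirichlet_sum_ge) (use assms m in auto)
  have s1: "(\<Sum>i\<le>l + Suc k. f i) = (\<Sum>i\<le>k. f i) + (\<Sum>i\<le>l. f (i + Suc k))" for f :: "nat \<Rightarrow> real"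
    by (induction l) auto
  have s2: "(\<Sum>i<l + Suc k. f i) = (\<Sum>i<k. f i) + f k + (\<Sum>i<l. f (i + Suc k))" for f :: "nat \<Rightarrow> real"
    by (induction l) auto
  have "(y k)\<^sup>2 + (z 0)\<^sup>2 \<le> (y (Suc k) - y k)\<^sup>2" "(z l)\<^sup>2 + (y 0)\<^sup>2 \<le> (y 0 - y m)\<^sup>2"
    using assms m by (auto simp: z_def intro!: sq_diff_ge_of_opposite_signs)
  then show ?thesis
    using 1 2 unfolding m s1 s2 z_def by (simp add: distrib_left)
qed

lemma sum_periodic_shift:
  fixes f :: "nat \<Rightarrow> real"
  assumes "\<And>i. f (i + n) = f i"
  shows "(\<Sum>i<n. f (i + k)) = (\<Sum>i<n. f i)"
proof (induction k)
  case (Suc k)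
  have "(\<Sum>i<n. f (i + Suc k)) + f k = f (n + k) + (\<Sum>i<n. f (i + k))"
    using sum.lessThan_Suc_shift[of "\<lambda>i. f (i + k)" n] by simp
  then show ?case using Suc assms[of k] by (simp add: add.commute)
qed simp

text \<open>A closed chain of values straddling \<open>0\<close> changes sign at least twice; cutting it there
  leaves two Dirichlet paths.\<close>
lemma cycle_sum_ge:
  fixes y :: "nat \<Rightarrow> real"
  assumes "2 \<le> n" "n \<le> N" and per: "\<And>i. y (i + n) = y i"
    and "i < n" "y i \<le> 0" "j < n" "0 \<le> y j"
  shows "2 * (1 - cos (pi / real N)) * (\<Sum>i<n. (y i)\<^sup>2) \<le> (\<Sum>i<n. (y (Suc i) - y i)\<^sup>2)"
proof -
  \<comment> \<open>Unrolling by one period places the nonnegative value after the nonpositive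
    one.\<close>
  have "i < j + n" "0 \<le> y (j + n)" using assms by auto
  from sign_change_index[of i "j + n" y] this assms(5) obtain k0
    where k0: "y k0 \<le> 0" "0 \<le> y (Suc k0)" by blast
  define m where "m = n - 1"
  have n: "n = Suc m" "m > 0" using assms by (auto simp: m_def)
  \<comment> \<open>Starting right after the first sign change puts that change on the closing edge;
    the second one is then found between \<open>z 0\<close> and \<open>z m\<close>.\<close>
  define z where "z = (\<lambda>i. y (i + Suc k0))"
  have "z m = y (k0 + n)" by (simp add: z_def n algebra_simps)
  then have zm: "z m \<le> 0" using k0 per by simp
  have z0: "0 \<le> z 0" using k0 by (simp add: z_def)
  obtain k where k: "k < m" "z k \<ge> 0" "z (Suc k) \<le> 0"
    using sign_change_index[of 0 m "\<lambda>i. - z i"] z0 zm n by auto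
  have "2 * (1 - cos (pi / real N)) * (\<Sum>i\<le>m. (z i)\<^sup>2)
     \<le> (\<Sum>i<m. (z (Suc i) - z i)\<^sup>2) + (z 0 - z m)\<^sup>2"
    by (rule cycle_sum_ge_aux[of k])
       (use k z0 zm n assms in \<open>auto intro: mult_nonneg_nonpos mult_nonpos_nonneg\<close>)
  moreover have "z (Suc m) = z 0"
    using per[of "Suc k0"] by (simp add: z_def n algebra_simps)
  ultimately have "2 * (1 - cos (pi / real N)) * (\<Sum>i<n. (z i)\<^sup>2) \<le> (\<Sum>i<n. (z (Suc i) - z i)\<^sup>2)"
    by (simp add: n lessThan_Suc_atMost[symmetric])
  moreover have "(\<Sum>i<n. (z i)\<^sup>2) = (\<Sum>i<n. (y i)\<^sup>2)"
    unfolding z_def using sum_periodic_shift[of "\<lambda>i. (y i)\<^sup>2" n "Suc k0"] per by simp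
  moreover have "(\<Sum>i<n. (z (Suc i) - z i)\<^sup>2) = (\<Sum>i<n. (y (Suc i) - y i)\<^sup>2)"
    unfolding z_def using sum_periodic_shift[of "\<lambda>i. (y (Suc i) - y i)\<^sup>2" n "Suc k0"] per
    by (metis (no_types, lifting) add_Suc sum.cong)
  ultimately show ?thesis by simp
qed

subsection \<open>Barycentric coordinates in the plane\<close>

text \<open>The determinant, that is, twice the signed area of the triangle spanned by the two
  vectors.\<close>

definition cross2 :: "pt \<Rightarrow> pt \<Rightarrow> real" where
  "cross2 u w = u $ 1 * w $ 2 - u $ 2 * w $ 1"

text \<open>The barycentric coordinate of the first point as a quotient of signed areas. It is
  affine on the whole plane, and its sign tells the side of the line through \<open>q\<close> and
  \<open>r\<close>, whatever the orientation of the triangle.\<close>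

definition bary :: "pt \<Rightarrow> pt \<Rightarrow> pt \<Rightarrow> pt \<Rightarrow> real" where
  "bary p q r x = cross2 (q - x) (r - x) / cross2 (q - p) (r - p)"

text \<open>Lagrange's identity. It yields Heron's formula for the area bound and the sine of the
  angle for the cotangent bound.\<close>

lemma cross2_sq: "(cross2 u w)\<^sup>2 + (u \<bullet> w)\<^sup>2 = (norm u)\<^sup>2 * (norm w)\<^sup>2"
  unfolding cross2_def power2_norm_eq_inner
  by (simp add: inner_vec_def sum_2 power2_eq_square algebra_simps)

lemma cross2_rotate: "cross2 (r - q) (p - q) = cross2 (q - p) (r - p)"
  by (simp add: cross2_def algebra_simps)

lemma cross2_swap: "cross2 w u = - cross2 u w"
  by (simp add: cross2_def)

lemma cross2_eq_0_imp_collinear: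
  assumes "cross2 u w = 0" "u \<noteq> 0"
  shows "\<exists>t. w = t *\<^sub>R u"
proof -
  have uu: "u \<bullet> u \<noteq> 0" using assms by simp
  have *: "u $ 1 * w $ 2 = u $ 2 * w $ 1" using assms(1) by (simp add: cross2_def)
  have "(u \<bullet> u) *\<^sub>R w = (u \<bullet> w) *\<^sub>R u"
    unfolding vec_eq_iff forall_2 inner_vec_def sum_2 using * by (simp add: algebra_simps)
  then have "inverse (u \<bullet> u) *\<^sub>R (u \<bullet> u) *\<^sub>R w = inverse (u \<bullet> u) *\<^sub>R (u \<bullet> w) *\<^sub>R u"
    by simp
  then have "w = (inverse (u \<bullet> u) * (u \<bullet> w)) *\<^sub>R u"
    using uu by simp
  then show ?thesis by blast
qed

lemma is_triangleE:
  assumes "is_triangle T" "p \<in> T"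
  obtains q r where "T = {p, q, r}" "p \<noteq> q" "p \<noteq> r" "q \<noteq> r" "cross2 (q - p) (r - p) \<noteq> 0"
proof -
  have "card (T - {p}) = 2"
    using assms by (simp add: is_triangle_def)
  then obtain q r where qr: "T - {p} = {q, r}" "q \<noteq> r"
    by (auto simp: card_2_iff)
  then have T: "T = {p, q, r}" and ne: "p \<noteq> q" "p \<noteq> r"
    using assms(2) by auto
  have "cross2 (q - p) (r - p) \<noteq> 0"
  proof
    assume "cross2 (q - p) (r - p) = 0"
    then obtain t where "r - p = t *\<^sub>R (q - p)"
      using cross2_eq_0_imp_collinear ne by (metis right_minus_eq)
    then have "r = (1 - t) *\<^sub>R p + t *\<^sub>R q" by (simp add: algebra_simps)
    then have "r \<in> affine hull {p, q}" unfolding affine_hull_2 by (force intro: exI[of _ "1 - t"] exI[of _ t])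
    moreover have "{p, q, r} - {r} = {p, q}" using ne qr by auto
    ultimately have "affine_dependent T"
      unfolding affine_dependent_def T by (intro bexI[of _ r]) auto
    then show False using assms by (simp add: is_triangle_def)
  qed
  then show ?thesis using that T ne qr by blast
qed

lemma is_triangle_third:
  assumes "is_triangle T" "p \<in> T" "q \<in> T" "p \<noteq> q"
  obtains r where "T = {p, q, r}" "p \<noteq> r" "q \<noteq> r" "cross2 (q - p) (r - p) \<noteq> 0"
proof -
  obtain q' r' where *: "T = {p, q', r'}" "p \<noteq> q'" "p \<noteq> r'" "q' \<noteq> r'" "cross2 (q' - p) (r' - p) \<noteq> 0"
    using is_triangleE[OF assms(1,2)] by metis
  show ?thesis
  proof (cases "q = q'")
    case True then show ?thesis using * that by blast
  next
    case False
    then have "q = r'" using * assms by auto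
    then show ?thesis
      using * that[of q'] cross2_swap[of "q' - p" "r' - p"] by (auto simp: insert_commute)
  qed
qed

lemma affine_fun_comb3:
  assumes "affine_fun f" "u + v + w = 1"
  shows "f (u *\<^sub>R p + v *\<^sub>R q + w *\<^sub>R r) = u * f p + v * f q + w * f r"
proof -
  obtain b c where f: "\<And>x. f x = b \<bullet> x + c" using assms(1) unfolding affine_fun_def by blast
  have "u * c + v * c + w * c = (u + v + w) * c" by (simp only: distrib_right)
  then have "u * c + v * c + w * c = c" by (simp add: assms(2))
  then show ?thesis unfolding f by (simp add: inner_add_right algebra_simps)
qed

lemma affine_fun_midpoint:
  assumes "affine_fun f"
  shows "f (midpoint a b) = (f a + f b) / 2"
  using affine_fun_comb3[OF assms, of "1/2" "1/2" 0 a b a]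
  by (simp add: midpoint_def field_simps scaleR_add_right)

lemma affine_fun_continuous: "affine_fun f \<Longrightarrow> continuous_on S f"
proof -
  assume "affine_fun f"
  then obtain b c where "f = (\<lambda>x. b \<bullet> x + c)" unfolding affine_fun_def by auto
  then show ?thesis by (simp add: continuous_intros)
qed

lemma affine_fun_bary: "affine_fun (bary p q r)"
proof -
  define D where "D = cross2 (q - p) (r - p)"
  define b :: pt where "b = vector [(q $ 2 - r $ 2) / D, (r $ 1 - q $ 1) / D]"
  have "bary p q r x = b \<bullet> x + cross2 q r / D" for x
    unfolding bary_def D_def[symmetric] b_def
    by (simp add: inner_vec_def sum_2 cross2_def diff_divide_distrib[symmetric] add_divide_distrib[symmetric] algebra_simps)
  then show ?thesis unfolding affine_fun_def by blast
qed

lemma bary_vertices: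
  assumes "cross2 (q - p) (r - p) \<noteq> 0"
  shows "bary p q r p = 1" "bary p q r q = 0" "bary p q r r = 0"
  using assms by (simp_all add: bary_def cross2_def)

lemma bary_other:
  shows "bary q r p x = cross2 (r - x) (p - x) / cross2 (q - p) (r - p)"
    and "bary r p q x = cross2 (p - x) (q - x) / cross2 (q - p) (r - p)"
  using cross2_rotate[of r q p] cross2_rotate[of p r q] by (simp_all add: bary_def)

lemma bary_sum:
  assumes "cross2 (q - p) (r - p) \<noteq> 0"
  shows "bary p q r x + bary q r p x + bary r p q x = 1"
proof -
  have "cross2 (q - x) (r - x) + cross2 (r - x) (p - x) + cross2 (p - x) (q - x) = cross2 (q - p) (r - p)"
    by (simp add: cross2_def algebra_simps)
  then show ?thesis
    unfolding bary_other(1)[of q r p] bary_other(2)[of r p q] bary_def[of p q r]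
    by (simp add: assms add_divide_distrib[symmetric])
qed

lemma bary_repr:
  assumes "cross2 (q - p) (r - p) \<noteq> 0"
  shows "bary p q r x *\<^sub>R p + bary q r p x *\<^sub>R q + bary r p q x *\<^sub>R r = x"
proof -
  define D where "D = cross2 (q - p) (r - p)"
  have "cross2 (q - x) (r - x) * p $ i + cross2 (r - x) (p - x) * q $ i + cross2 (p - x) (q - x) * r $ i
     = D * x $ i" if "i = 1 \<or> i = 2" for i
    using that by (auto simp: D_def cross2_def algebra_simps)
  then have *: "(cross2 (q - x) (r - x) * p $ i + cross2 (r - x) (p - x) * q $ i + cross2 (p - x) (q - x) * r $ i) / D
     = x $ i" for i :: 2
    using exhaust_2[of i] assms by (simp add: D_def)
  show ?thesis
    unfolding vec_eq_iff bary_other(1)[of q r p] bary_other(2)[of r p q] bary_def[of p q r] D_def[symmetric]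
    using * by (simp add: add_divide_distrib)
qed

lemma in_triangle_iff:
  assumes "cross2 (q - p) (r - p) \<noteq> 0"
  shows "x \<in> convex hull {p, q, r} \<longleftrightarrow> 0 \<le> bary p q r x \<and> 0 \<le> bary q r p x \<and> 0 \<le> bary r p q x"
proof
  assume "x \<in> convex hull {p, q, r}"
  then obtain u v w where x: "x = u *\<^sub>R p + v *\<^sub>R q + w *\<^sub>R r" and uvw: "0 \<le> u" "0 \<le> v" "0 \<le> w" "u + v + w = 1"
    by (auto simp: convex_hull_3)
  have D: "cross2 (r - q) (p - q) \<noteq> 0" "cross2 (p - r) (q - r) \<noteq> 0"
    using assms cross2_rotate[of r q p] cross2_rotate[of p r q] by simp_all
  show "0 \<le> bary p q r x \<and> 0 \<le> bary q r p x \<and> 0 \<le> bary r p q x"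
    unfolding x using uvw
    by (simp add: affine_fun_comb3[OF affine_fun_bary] bary_vertices[OF assms] bary_vertices[OF D(1)] bary_vertices[OF D(2)])
next
  assume "0 \<le> bary p q r x \<and> 0 \<le> bary q r p x \<and> 0 \<le> bary r p q x"
  then show "x \<in> convex hull {p, q, r}"
    unfolding convex_hull_3 using bary_sum[OF assms, of x] bary_repr[OF assms, of x]
    by (intro CollectI exI[of _ "bary p q r x"] exI[of _ "bary q r p x"] exI[of _ "bary r p q x"]) auto
qed

section \<open>Local shape of a triangle near a point\<close>

lemma affine_fun_pos_eventually:
  fixes f :: "pt \<Rightarrow> real"
  assumes "affine_fun f" "0 < f x"
  shows "eventually (\<lambda>y. 0 < f y) (nhds x)"
proof -
  have "isCont f x"
    using affine_fun_continuous[OF assms(1), of UNIV] by (simp add: continuous_on_eq_continuous_at)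
  then have "filterlim f (nhds (f x)) (nhds x)"
    by (simp add: continuous_within tendsto_nhds_iff isCont_def)
  then show ?thesis using assms(2) order_tendstoD(1) by blast
qed

text \<open>Near a relatively interior point of the edge \<open>p q\<close> the constraints of the
  other two edges are inactive, so the triangle looks like a half plane.\<close>

lemma half_disc_in_triangle:
  assumes "cross2 (q - p) (r - p) \<noteq> 0" "0 < bary p q r x" "0 < bary q r p x"
  shows "eventually (\<lambda>y. 0 \<le> bary r p q y \<longrightarrow> y \<in> convex hull {p, q, r}) (nhds x)"
  using affine_fun_pos_eventually[OF affine_fun_bary assms(2)]
    affine_fun_pos_eventually[OF affine_fun_bary assms(3)]
  by eventually_elim (auto simp: in_triangle_iff[OF assms(1)])

lemma convex_hull_affine_fun_eq_0:
  assumes "affine_fun f" "\<And>y. y \<in> S \<Longrightarrow> f y = 0" "x \<in> convex hull S"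
  shows "f x = 0"
proof -
  obtain b c where f: "\<And>x. f x = b \<bullet> x + c" using assms(1) unfolding affine_fun_def by blast
  have "convex hull S \<subseteq> {x. b \<bullet> x = - c}"
    using assms(2) f by (intro hull_minimal convex_hyperplane) (force simp: eq_neg_iff_add_eq_0)
  then show ?thesis using assms(3) f by auto
qed

text \<open>Without \<open>p\<close>, the hull of \<open>S\<close> lies on the line where this
  coordinate vanishes. The lemma extracts common vertices from a point in the intersection of two
  triangles.\<close>

lemma bary_pos_imp_vertex:
  assumes "cross2 (q - p) (r - p) \<noteq> 0" "S \<subseteq> {p, q, r}" "x \<in> convex hull S" "0 < bary p q r x"
  shows "p \<in> S"
proof (rule ccontr)
  assume "p \<notin> S"
  then have "bary p q r y = 0" if "y \<in> S" for y
    using assms(2) bary_vertices(2,3)[OF assms(1)] that by blast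
  then have "bary p q r x = 0"
    using convex_hull_affine_fun_eq_0[OF affine_fun_bary _ assms(3)] by blast
  then show False using assms(4) by simp
qed

text \<open>Pushing a boundary point by t in the direction that \<open>R\<close> maps to the second
  axis puts it strictly above the graph, in an open set disjoint from \<Omega> and hence from its
  closure. This excludes slits, so an edge shared by two triangles runs inside \<Omega>.\<close>

lemma interior_closure_lipschitz_domain:
  assumes "lipschitz_domain \<Omega>"
  shows "interior (closure \<Omega>) \<subseteq> \<Omega>"
proof
  fix p assume p: "p \<in> interior (closure \<Omega>)"
  show "p \<in> \<Omega>"
  proof (rule ccontr)
    assume np: "p \<notin> \<Omega>"
    have op: "open \<Omega>" using assms by (simp add: lipschitz_domain_def)
    then have pf: "p \<in> frontier \<Omega>"
      using p np interior_subset by (auto simp: frontier_def interior_open)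
    have "\<forall>p\<in>frontier \<Omega>. \<exists>r>0. \<exists>(R::pt \<Rightarrow> pt) (g::real \<Rightarrow> real) L.
        orthogonal_transformation R \<and> (\<forall>s t. \<bar>g s - g t\<bar> \<le> L * \<bar>s - t\<bar>) \<and>
        (\<forall>x\<in>ball p r. x \<in> \<Omega> \<longleftrightarrow> (R x) $ 2 < g ((R x) $ 1))"
      using assms unfolding lipschitz_domain_def by (elim conjE)
    from bspec[OF this pf] obtain r R g L where r: "r > 0" and R: "orthogonal_transformation (R::pt \<Rightarrow> pt)"
      and g: "\<And>s t::real. \<bar>g s - g t\<bar> \<le> L * \<bar>s - t\<bar>"
      and iff: "\<And>x. x \<in> ball p r \<Longrightarrow> x \<in> \<Omega> \<longleftrightarrow> (R x) $ 2 < g ((R x) $ 1)"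
      by blast
    obtain e where e: "e > 0" "ball p e \<subseteq> closure \<Omega>"
      using p by (auto simp: mem_interior)
    define t where "t = min r e / 2"
    have t: "t > 0" "t < r" "t < e" using r e by (auto simp: t_def)
    have linR: "linear R" using R by (rule orthogonal_transformation_linear)
    obtain w where w: "R w = axis 2 t"
      using orthogonal_transformation_surj[OF R] by (metis surjD)
    have "norm w = norm (R w)" using R by (simp add: orthogonal_transformation_norm)
    then have nw: "norm w = t" using w t by (simp add: norm_eq_sqrt_inner[of "axis 2 t"] inner_axis_axis)
    define y where "y = p + w"
    have y: "y \<in> ball p r" "y \<in> ball p e"
      using t nw by (auto simp: y_def dist_norm)
    have Ry: "R y $ 1 = R p $ 1" "R y $ 2 = R p $ 2 + t"
      using w by (auto simp: y_def linear_add[OF linR] axis_def)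
    have "\<not> R p $ 2 < g (R p $ 1)" using iff[of p] np r by auto
    then have gt: "g (R y $ 1) < R y $ 2" using Ry t by simp
    have "L-lipschitz_on UNIV g"
    proof (rule lipschitz_onI)
      show "dist (g s) (g t) \<le> L * dist s t" for s t using g by (simp add: dist_real_def)
      show "0 \<le> L" using g[of 0 1] by simp
    qed
    then have cg: "continuous_on UNIV g" by (rule lipschitz_on_continuous_on)
    have cR: "continuous_on UNIV R" using linR by (simp add: linear_continuous_on linear_linear)
    have "open {x. g (R x $ 1) < R x $ 2}"
      by (intro open_Collect_less continuous_intros continuous_on_compose2[OF cg] cR) auto
    then have "open ({x. g (R x $ 1) < R x $ 2} \<inter> ball p r)" by auto
    moreover have "({x. g (R x $ 1) < R x $ 2} \<inter> ball p r) \<inter> \<Omega> = {}" using iff by force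
    ultimately have "({x. g (R x $ 1) < R x $ 2} \<inter> ball p r) \<inter> closure \<Omega> = {}"
      by (simp add: open_Int_closure_eq_empty)
    moreover have "y \<in> {x. g (R x $ 1) < R x $ 2} \<inter> ball p r \<inter> closure \<Omega>"
      using y gt e(2) by blast
    ultimately show False by blast
  qed
qed

subsection \<open>Edges of a triangulation\<close>

lemma bary_on_open_segment:
  assumes "cross2 (q - p) (r - p) \<noteq> 0" "x \<in> open_segment p q"
  shows "0 < bary p q r x" "0 < bary q r p x" "bary r p q x = 0"
proof -
  obtain u where u: "0 < u" "u < 1" "x = (1 - u) *\<^sub>R p + u *\<^sub>R q"
    using assms(2) by (auto simp: in_segment)
  have D: "cross2 (r - q) (p - q) \<noteq> 0" "cross2 (p - r) (q - r) \<noteq> 0"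
    using assms cross2_rotate[of r q p] cross2_rotate[of p r q] by simp_all
  have *: "f x = (1 - u) * f p + u * f q" if "affine_fun f" for f
    using affine_fun_comb3[OF that, of "1 - u" u 0 p q p] u(3) by simp
  show "0 < bary p q r x" "0 < bary q r p x" "bary r p q x = 0"
    using u(1,2) by (simp_all add: *[OF affine_fun_bary] bary_vertices[OF assms(1)]
        bary_vertices[OF D(1)] bary_vertices[OF D(2)])
qed

text \<open>Both coordinates are affine and vanish on the line through \<open>p\<close> and
  \<open>q\<close>, hence are proportional. The sign of the factor decides whether the two apexes
  lie on the same side.\<close>

lemma bary_change_apex:
  assumes "cross2 (q - p) (r' - p) \<noteq> 0"
  shows "bary r p q y = bary r p q r' * bary r' p q y"
proof -
  have "cross2 (p - r') (q - r') \<noteq> 0"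
    using assms cross2_rotate[of p r' q] cross2_rotate[of r' q p] by simp
  then show ?thesis by (simp add: bary_def)
qed

lemma eventually_nhds_ray:
  fixes x w :: "'a :: real_normed_vector"
  assumes "eventually P (nhds x)"
  obtains t where "0 < t" "t < 1" "P (x + t *\<^sub>R w)"
proof -
  have "((\<lambda>t. x + t *\<^sub>R w) \<longlongrightarrow> x + 0 *\<^sub>R w) (at_right 0)"
    by (intro tendsto_intros)
  then have "eventually (\<lambda>t. P (x + t *\<^sub>R w)) (at_right 0)"
    using assms by (simp add: filterlim_iff)
  moreover have "eventually (\<lambda>t::real. t < 1) (at_right 0)" "eventually (\<lambda>t::real. 0 < t) (at_right 0)"
    by (auto simp: eventually_at_right_less intro: eventually_at_rightI[of 0 1])
  ultimately have "eventually (\<lambda>t. 0 < t \<and> t < 1 \<and> P (x + t *\<^sub>R w)) (at_right 0)"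
    by eventually_elim auto
  then show ?thesis
    using that eventually_happens'[OF trivial_limit_at_right_real] by blast
qed

lemma eventually_nhds_imp_interior:
  "eventually (\<lambda>y. y \<in> S) (nhds x) \<Longrightarrow> x \<in> interior S"
  unfolding eventually_nhds interior_def by auto

locale lipschitz_triangulation =
  fixes \<Omega> :: "pt set" and \<T> :: "pt set set"
  assumes dom: "lipschitz_domain \<Omega>" and tri: "regular_triangulation \<Omega> \<T>"
begin

lemma finite_triangulation: "finite \<T>"
  and is_triangle: "T \<in> \<T> \<Longrightarrow> is_triangle T"
  and triangles_cover: "\<Union> ((\<lambda>T. convex hull T) ` \<T>) = closure \<Omega>"
  and triangles_Int: "T \<in> \<T> \<Longrightarrow> T' \<in> \<T> \<Longrightarrow> T \<noteq> T' \<Longrightarrow>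
    convex hull T \<inter> convex hull T' = convex hull (T \<inter> T')"
  using tri by (auto simp: regular_triangulation_def)

lemma triangle_subset_closure: "T \<in> \<T> \<Longrightarrow> convex hull T \<subseteq> closure \<Omega>"
  using triangles_cover by blast

lemma edge_apex:
  assumes "T \<in> \<T>" "p \<noteq> q" "{p, q} \<subseteq> T"
  obtains r where "T = {p, q, r}" "cross2 (q - p) (r - p) \<noteq> 0"
proof -
  have "p \<in> T" "q \<in> T" using assms(3) by simp_all
  from is_triangle_third[OF is_triangle[OF assms(1)] this assms(2)] show ?thesis
    using that by metis
qed

text \<open>If the apexes lay on the same side, a point just off the edge midpoint towards
  \<open>r\<close> would belong to both triangles, hence to their common edge, where the coordinate
  of \<open>r\<close> is zero.\<close>

lemma opposite_sides:
  assumes T: "{p, q, r} \<in> \<T>" "{p, q, r'} \<in> \<T>" "{p, q, r} \<noteq> {p, q, r'}"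
    and D: "cross2 (q - p) (r - p) \<noteq> 0" "cross2 (q - p) (r' - p) \<noteq> 0"
  shows "bary r p q r' < 0"
proof (rule ccontr)
  assume neg: "\<not> bary r p q r' < 0"
  have pq: "p \<noteq> q" and r: "r \<noteq> p" "r \<noteq> q" and r': "r' \<noteq> p" "r' \<noteq> q"
    using D by (auto simp: cross2_def)
  have Dr: "cross2 (p - r) (q - r) \<noteq> 0" using D(1) cross2_rotate[of p r q] cross2_rotate[of r q p] by simp
  have "r \<noteq> r'" using T(3) by blast
  then have I: "{p, q, r} \<inter> {p, q, r'} = {p, q}" using r r' by auto
  have m: "midpoint p q \<in> open_segment p q" using pq by simp
  have "eventually (\<lambda>y. (0 \<le> bary r p q y \<longrightarrow> y \<in> convex hull {p, q, r}) \<and>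
     (0 \<le> bary r' p q y \<longrightarrow> y \<in> convex hull {p, q, r'})) (nhds (midpoint p q))"
    using half_disc_in_triangle[OF D(1) bary_on_open_segment(1,2)[OF D(1) m]]
      half_disc_in_triangle[OF D(2) bary_on_open_segment(1,2)[OF D(2) m]]
    by eventually_elim auto
  then obtain t where t: "0 < t" "t < 1"
    and y: "0 \<le> bary r p q (midpoint p q + t *\<^sub>R (r - midpoint p q)) \<longrightarrow>
       midpoint p q + t *\<^sub>R (r - midpoint p q) \<in> convex hull {p, q, r}"
     "0 \<le> bary r' p q (midpoint p q + t *\<^sub>R (r - midpoint p q)) \<longrightarrow>
       midpoint p q + t *\<^sub>R (r - midpoint p q) \<in> convex hull {p, q, r'}"
    by (rule eventually_nhds_ray) blast
  define y where "y = midpoint p q + t *\<^sub>R (r - midpoint p q)"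
  have "y = (1 - t) *\<^sub>R midpoint p q + t *\<^sub>R r + 0 *\<^sub>R r" by (simp add: y_def algebra_simps)
  then have ry: "bary r p q y = t"
    using affine_fun_comb3[OF affine_fun_bary[of r p q], of "1 - t" t 0 "midpoint p q" r r]
      bary_on_open_segment(3)[OF D(1) m] bary_vertices(1)[OF Dr] by simp
  then have "0 < bary r p q r' * bary r' p q y" using bary_change_apex[OF D(2), of r y] t by simp
  then have "0 < bary r' p q y" using neg by (simp add: zero_less_mult_iff not_less)
  then have "y \<in> convex hull {p, q, r} \<inter> convex hull {p, q, r'}"
    using y t ry unfolding y_def[symmetric] by simp
  then have "y \<in> convex hull {p, q}" using triangles_Int[OF T] I by simp
  then have "r \<in> {p, q}"
    by (rule bary_pos_imp_vertex[OF Dr, rotated]) (use ry t in auto)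
  then show False using r by simp
qed

text \<open>The two triangles contain half discs on opposite sides of the edge, and these fill a
  disc.\<close>

lemma open_edge_interior:
  assumes T: "T \<in> \<T>" "T' \<in> \<T>" "T \<noteq> T'" and pq: "p \<noteq> q" "{p, q} \<subseteq> T" "{p, q} \<subseteq> T'"
    and x: "x \<in> open_segment p q"
  shows "x \<in> interior (convex hull T \<union> convex hull T')"
proof -
  obtain r where r: "T = {p, q, r}" "cross2 (q - p) (r - p) \<noteq> 0"
    by (rule edge_apex[OF T(1) pq(1,2)])
  obtain r' where r': "T' = {p, q, r'}" "cross2 (q - p) (r' - p) \<noteq> 0"
    by (rule edge_apex[OF T(2) pq(1,3)])
  have neg: "bary r p q r' < 0"
    by (rule opposite_sides) (use T r r' in auto)
  have "eventually (\<lambda>y. y \<in> convex hull T \<union> convex hull T') (nhds x)"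
    using half_disc_in_triangle[OF r(2) bary_on_open_segment(1,2)[OF r(2) x]]
      half_disc_in_triangle[OF r'(2) bary_on_open_segment(1,2)[OF r'(2) x]]
  proof eventually_elim
    case (elim y)
    have "0 \<le> bary r p q y \<or> 0 \<le> bary r' p q y"
      using bary_change_apex[OF r'(2), of r y] neg by (cases "0 \<le> bary r' p q y") (auto simp: zero_le_mult_iff)
    then show ?case using elim r r' by blast
  qed
  then show ?thesis by (rule eventually_nhds_imp_interior)
qed

lemma open_edge_in_domain:
  assumes "T \<in> \<T>" "T' \<in> \<T>" "T \<noteq> T'" "p \<noteq> q" "{p, q} \<subseteq> T" "{p, q} \<subseteq> T'"
  shows "open_segment p q \<subseteq> \<Omega>"
proof
  fix x assume "x \<in> open_segment p q"
  then have "x \<in> interior (convex hull T \<union> convex hull T')"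
    using open_edge_interior assms by blast
  also have "\<dots> \<subseteq> interior (closure \<Omega>)"
    using triangle_subset_closure assms by (intro interior_mono) blast
  finally show "x \<in> \<Omega>" using interior_closure_lipschitz_domain[OF dom] by blast
qed

text \<open>Three apexes cannot be pairwise on opposite sides of a line: the product of two negative
  factors would have to be negative.\<close>

lemma edge_at_most_two:
  assumes "T \<in> \<T>" "T' \<in> \<T>" "T'' \<in> \<T>" "T \<noteq> T'" "T \<noteq> T''"
    and pq: "p \<noteq> q" "{p, q} \<subseteq> T" "{p, q} \<subseteq> T'" "{p, q} \<subseteq> T''"
  shows "T' = T''"
proof (rule ccontr)
  assume "T' \<noteq> T''"
  obtain r where r: "T = {p, q, r}" "cross2 (q - p) (r - p) \<noteq> 0"
    by (rule edge_apex[OF assms(1) pq(1,2)])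
  obtain r' where r': "T' = {p, q, r'}" "cross2 (q - p) (r' - p) \<noteq> 0"
    by (rule edge_apex[OF assms(2) pq(1,3)])
  obtain r'' where r'': "T'' = {p, q, r''}" "cross2 (q - p) (r'' - p) \<noteq> 0"
    by (rule edge_apex[OF assms(3) pq(1,4)])
  have "bary r p q r' < 0"
    by (rule opposite_sides) (use assms r r' in simp_all)
  moreover have "bary r p q r'' < 0"
    by (rule opposite_sides) (use assms r r'' in simp_all)
  moreover have "bary r' p q r'' < 0"
    by (rule opposite_sides) (use assms r' r'' \<open>T' \<noteq> T''\<close> in simp_all)
  ultimately show False
    using bary_change_apex[OF r'(2), of r r''] by (simp add: mult_less_0_iff)
qed

text \<open>If no other triangle contained \<open>x\<close>, a small step from \<open>x\<close> away
  from the apex would stay in \<Omega> and could only be covered by \<open>T\<close>, although the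
  apex coordinate has become negative. Positivity of the coordinates of \<open>p\<close> and
  \<open>q\<close> at \<open>x\<close> then forces both to be vertices of the second triangle, so
  there are no hanging nodes.\<close>

lemma edge_neighbour_exists:
  assumes T: "T \<in> \<T>" and pq: "p \<noteq> q" "{p, q} \<subseteq> T" and x: "x \<in> open_segment p q" "x \<in> \<Omega>"
  shows "\<exists>T'\<in>\<T>. T' \<noteq> T \<and> {p, q} \<subseteq> T'"
proof -
  obtain r where r: "T = {p, q, r}" "cross2 (q - p) (r - p) \<noteq> 0"
    by (rule edge_apex[OF T pq])
  have Dr: "cross2 (r - q) (p - q) \<noteq> 0" "cross2 (p - r) (q - r) \<noteq> 0"
    using r(2) cross2_rotate[of p r q] cross2_rotate[of r q p] by simp_all
  define K where "K = \<Union> ((\<lambda>T. convex hull T) ` (\<T> - {T}))"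
  have "closed K" unfolding K_def
    using finite_triangulation is_triangle
    by (intro closed_Union) (auto simp: is_triangle_def card_eq_0_iff intro!: compact_imp_closed finite_imp_compact_convex_hull card_ge_0_finite)
  have "x \<in> K"
  proof (rule ccontr)
    assume "x \<notin> K"
    then have "x \<in> \<Omega> - K" using x by simp
    moreover have "open (\<Omega> - K)"
      using \<open>closed K\<close> dom by (auto simp: lipschitz_domain_def intro: open_Diff)
    ultimately have "eventually (\<lambda>y. y \<in> \<Omega> - K) (nhds x)"
      by (rule eventually_nhds_in_open[rotated])
    then obtain t where t: "0 < t" "t < 1" "x + t *\<^sub>R (x - r) \<in> \<Omega> - K"
      by (rule eventually_nhds_ray)
    define y where "y = x + t *\<^sub>R (x - r)"
    have "y \<in> closure \<Omega>" "y \<notin> K" using t closure_subset by (auto simp: y_def)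
    then have "y \<in> convex hull T" unfolding triangles_cover[symmetric] K_def by auto
    then have "0 \<le> bary r p q y" using in_triangle_iff[OF r(2)] r(1) by blast
    moreover have "y = (1 + t) *\<^sub>R x + (- t) *\<^sub>R r + 0 *\<^sub>R r" by (simp add: y_def algebra_simps)
    then have "bary r p q y = - t"
      using affine_fun_comb3[OF affine_fun_bary[of r p q], of "1 + t" "- t" 0 x r r]
        bary_on_open_segment(3)[OF r(2) x(1)] bary_vertices(1)[OF Dr(2)] by simp
    ultimately show False using t by simp
  qed
  then obtain T' where T': "T' \<in> \<T>" "T' \<noteq> T" "x \<in> convex hull T'" by (auto simp: K_def)
  have "x \<in> convex hull {p, q}" using open_closed_segment[OF x(1)] by (simp add: segment_convex_hull)
  then have "x \<in> convex hull T" using hull_mono[of "{p, q}" T convex] pq by blast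
  then have xi: "x \<in> convex hull (T \<inter> T')" using T' triangles_Int[OF T T'(1)] by blast
  have "p \<in> T \<inter> T'"
    by (rule bary_pos_imp_vertex[OF r(2) _ xi bary_on_open_segment(1)[OF r(2) x(1)]]) (use r in auto)
  moreover have "q \<in> T \<inter> T'"
    by (rule bary_pos_imp_vertex[OF Dr(1) _ xi bary_on_open_segment(2)[OF r(2) x(1)]]) (use r in auto)
  ultimately show ?thesis using T' by blast
qed

text \<open>Translates the topological conditions on midpoints in \<open>CR10\<close> into the
  combinatorial ones of the link graph.\<close>

lemma edge_midpoint_cases:
  assumes "T \<in> \<T>" "p \<noteq> q" "{p, q} \<subseteq> T"
  shows "midpoint p q \<in> frontier \<Omega> \<longleftrightarrow> \<not> (\<exists>T'\<in>\<T>. T' \<noteq> T \<and> {p, q} \<subseteq> T')"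
proof -
  have m: "midpoint p q \<in> open_segment p q" using assms by simp
  have "midpoint p q \<in> convex hull {p, q}"
    by (simp flip: segment_convex_hull)
  then have "midpoint p q \<in> closure \<Omega>"
    using hull_mono[of "{p, q}" T convex] assms triangle_subset_closure by blast
  moreover have "open \<Omega>" using dom by (simp add: lipschitz_domain_def)
  ultimately have "midpoint p q \<in> frontier \<Omega> \<longleftrightarrow> midpoint p q \<notin> \<Omega>"
    by (simp add: frontier_def interior_open)
  also have "\<dots> \<longleftrightarrow> \<not> (\<exists>T'\<in>\<T>. T' \<noteq> T \<and> {p, q} \<subseteq> T')"
    using edge_neighbour_exists[OF assms m] open_edge_in_domain[of T _ p q] assms m by blast
  finally show ?thesis .
qed

end

subsection \<open>Stars of nodes\<close>

text \<open>A longest simple path in a graph of maximal degree two. By maximality a further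
  neighbour of an end lies on the path; an inner vertex of the path would then have three
  neighbours, so it can only be the other end, which closes a cycle.\<close>

lemma maximal_path_ends:
  fixes adj :: "'a \<Rightarrow> 'a \<Rightarrow> bool"
  assumes fin: "finite V" and vert: "\<And>x y. adj x y \<Longrightarrow> x \<in> V"
    and sym: "\<And>x y. adj x y \<Longrightarrow> adj y x" and irr: "\<And>x. \<not> adj x x"
    and deg: "\<And>x a b c. adj x a \<Longrightarrow> adj x b \<Longrightarrow> adj x c \<Longrightarrow> a = b \<or> a = c \<or> b = c"
    and edge: "adj x0 y0"
  obtains xs where "distinct xs" "2 \<le> length xs"
    "\<And>i. Suc i < length xs \<Longrightarrow> adj (xs ! i) (xs ! Suc i)"
    "3 \<le> length xs \<and> adj (last xs) (hd xs) \<or>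
     (\<forall>y. adj (xs ! 0) y \<longrightarrow> y = xs ! 1) \<and>
     (\<forall>y. adj (xs ! (length xs - 1)) y \<longrightarrow> y = xs ! (length xs - 2))"
proof -
  define P where "P = (\<lambda>xs. distinct xs \<and> 2 \<le> length xs \<and>
    (\<forall>i. Suc i < length xs \<longrightarrow> adj (xs ! i) (xs ! Suc i)))"
  have P0: "P [x0, y0]" using edge irr by (auto simp: P_def less_Suc_eq)
  have subV: "set xs \<subseteq> V" if "P xs" for xs
  proof
    fix x assume "x \<in> set xs"
    then obtain i where i: "i < length xs" "x = xs ! i" by (auto simp: in_set_conv_nth)
    show "x \<in> V"
    proof (cases "Suc i < length xs")
      case True then show ?thesis using that i vert by (auto simp: P_def)
    next
      case False
      then have "Suc (i - 1) < length xs" "Suc (i - 1) = i" using i that by (auto simp: P_def)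
      then have "adj (xs ! (i - 1)) (xs ! i)" using that by (metis P_def)
      then show ?thesis using i vert sym by blast
    qed
  qed
  have "length xs < Suc (card V)" if "P xs" for xs
  proof -
    have "length xs = card (set xs)" using that by (simp add: P_def distinct_card)
    then show ?thesis using card_mono[OF fin subV[OF that]] by simp
  qed
  then obtain xs where xs: "P xs" and max: "\<And>ys. P ys \<Longrightarrow> length ys \<le> length xs"
    using ex_has_greatest_nat[of P _ length "Suc (card V)"] P0 less_imp_le by metis
  \<comment> \<open>Formulated for every path of maximal length, so that reversal also covers the
    first vertex.\<close>
  have last_end: "y = ys ! 0 \<and> 3 \<le> length ys"
    if ys: "P ys" "length ys = length xs" and y: "adj (ys ! (length ys - 1)) y" "y \<noteq> ys ! (length ys - 2)" for ys y
  proof -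
    define n where "n = length ys"
    have n: "2 \<le> n" and dist: "distinct ys" and chain: "\<And>i. Suc i < n \<Longrightarrow> adj (ys ! i) (ys ! Suc i)"
      using ys by (auto simp: P_def n_def)
    have "y \<in> set ys"
    proof (rule ccontr)
      assume "y \<notin> set ys"
      moreover have "adj ((ys @ [y]) ! i) ((ys @ [y]) ! Suc i)" if "Suc i < length (ys @ [y])" for i
      proof (cases "Suc i < n")
        case True then show ?thesis using chain by (simp add: nth_append n_def)
      next
        case False
        then have "i = n - 1" "Suc i = n" using that by (auto simp: n_def)
        then show ?thesis using y n by (simp add: nth_append n_def)
      qed
      ultimately have "P (ys @ [y])" using dist n by (auto simp: P_def n_def)
      then show False using max[of "ys @ [y]"] ys by simp
    qed
    then obtain i where i: "i < n" "y = ys ! i" by (auto simp: in_set_conv_nth n_def)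
    have "i \<noteq> n - 1" using y irr i by (auto simp: n_def)
    moreover have "i \<noteq> n - 2" using y i by (auto simp: n_def)
    ultimately have i2: "Suc i < n - 1" using i by auto
    have "i = 0"
    proof (rule ccontr)
      assume "i \<noteq> 0"
      then obtain k where k: "i = Suc k" by (cases i) auto
      have "adj (ys ! i) (ys ! k)" using chain[of k] k i sym by auto
      moreover have "adj (ys ! i) (ys ! Suc i)" using chain[of i] i2 by auto
      moreover have "adj (ys ! i) (ys ! (n - 1))" using y(1) i sym by (auto simp: n_def)
      ultimately have "ys ! k = ys ! Suc i \<or> ys ! k = ys ! (n - 1) \<or> ys ! Suc i = ys ! (n - 1)"
        by (rule deg)
      moreover have "k < n" "Suc i < n" "n - 1 < n" using i2 k by auto
      ultimately have "k = Suc i \<or> k = n - 1 \<or> Suc i = n - 1"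
        using nth_eq_iff_index_eq[OF dist] by (auto simp: n_def)
      then show False using i2 k by auto
    qed
    then show ?thesis using i i2 by (auto simp: n_def)
  qed
  define n where "n = length xs"
  have n: "2 \<le> n" using xs by (simp add: P_def n_def)
  have hl: "last xs = xs ! (n - 1)" "hd xs = xs ! 0"
    using n last_conv_nth[of xs] hd_conv_nth[of xs] by (fastforce simp: n_def)+
  have rev: "P (rev xs)"
    unfolding P_def
  proof (intro conjI allI impI)
    fix i assume i: "Suc i < length (rev xs)"
    define k where "k = n - Suc (Suc i)"
    have "adj (xs ! k) (xs ! Suc k)" using xs i by (auto simp: P_def k_def n_def)
    moreover have "n - Suc i = Suc k" using i by (auto simp: k_def n_def)
    ultimately show "adj (rev xs ! i) (rev xs ! Suc i)"
      using i sym by (auto simp: rev_nth n_def k_def)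
  qed (use xs in \<open>auto simp: P_def\<close>)
  have L: "y = xs ! 0 \<and> 3 \<le> n" if "adj (xs ! (n - 1)) y" "y \<noteq> xs ! (n - 2)" for y
    using last_end[OF xs] that by (auto simp: n_def)
  have H: "y = xs ! (n - 1) \<and> 3 \<le> n" if "adj (xs ! 0) y" "y \<noteq> xs ! 1" for y
  proof -
    have "rev xs ! (n - 1) = xs ! 0" "rev xs ! (n - 2) = xs ! 1"
      using n by (auto simp: rev_nth n_def Suc_diff_Suc numeral_2_eq_2)
    moreover have "0 < length xs" using n unfolding n_def by linarith
    then have "rev xs ! 0 = xs ! (n - 1)" using rev_nth[of 0 xs] by (simp add: n_def)
    ultimately have "rev xs ! (n - 1) = xs ! 0" "rev xs ! (n - 2) = xs ! 1" "rev xs ! 0 = xs ! (n - 1)"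
      by simp_all
    then show ?thesis using last_end[OF rev] that by (auto simp: n_def)
  qed
  have "3 \<le> length xs \<and> adj (last xs) (hd xs) \<or>
     (\<forall>y. adj (xs ! 0) y \<longrightarrow> y = xs ! 1) \<and>
     (\<forall>y. adj (xs ! (length xs - 1)) y \<longrightarrow> y = xs ! (length xs - 2))"
    using L H sym hl by (metis n_def)
  then show ?thesis using that[of xs] xs by (auto simp: P_def)
qed

lemma add_mod_neq:
  fixes i k n :: nat
  assumes "0 < k" "k < n"
  shows "(i + k) mod n \<noteq> i mod n"
proof
  assume "(i + k) mod n = i mod n"
  then have "n dvd (i + k) - i" by (metis le_add1 mod_eq_dvd_iff_nat)
  then show False using assms by (auto dest: dvd_imp_le)
qed

lemma bary_swap: "bary p r q x = bary p q r x"
  using cross2_swap[of "r - x" "q - x"] cross2_swap[of "r - p" "q - p"] by (simp add: bary_def)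

context lipschitz_triangulation
begin

section \<open>Topology of the star of a node\<close>

lemma tri_at_iff: "T \<in> tri_at \<T> z \<longleftrightarrow> T \<in> \<T> \<and> z \<in> T"
  by (auto simp: tri_at_def)

lemma finite_tri_at: "finite (tri_at \<T> z)"
  using finite_triangulation by (simp add: tri_at_def)

lemma finite_vertices: "T \<in> \<T> \<Longrightarrow> finite T"
  using is_triangle[of T] by (intro card_ge_0_finite) (simp add: is_triangle_def)

text \<open>In a small punctured disc the union of \<open>C\<close> is closed, and it is open
  because each edge at \<open>z\<close> has triangles of \<open>C\<close> on both sides. A punctured
  disc in the plane is connected, so the union contains all of it.\<close>

lemma closed_star_covers:
  assumes C: "C \<subseteq> tri_at \<T> z" "C \<noteq> {}"
    and closed: "\<And>T a. T \<in> C \<Longrightarrow> a \<in> T \<Longrightarrow> a \<noteq> z \<Longrightarrow> \<exists>T'\<in>C. T' \<noteq> T \<and> a \<in> T'"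
  obtains e where "0 < e" "ball z e \<subseteq> \<Union> ((\<lambda>T. convex hull T) ` C)"
proof -
  define U where "U = \<Union> ((\<lambda>T. convex hull T) ` C)"
  have finC: "finite C" using C finite_tri_at finite_subset by blast
  have CT: "T \<in> \<T>" "z \<in> T" if "T \<in> C" for T using C that by (auto simp: tri_at_iff)
  have clU: "closed U" unfolding U_def
    using finC finite_vertices CT
    by (intro closed_Union) (auto intro!: compact_imp_closed finite_imp_compact_convex_hull)
  \<comment> \<open>The disc is so small that it misses the sides opposite to \<open>z\<close>. The
    determinant condition discards degenerate pairs such as \<open>a = b\<close> or
    \<open>a = z\<close>.\<close>
  have "eventually (\<lambda>y. \<forall>T\<in>C. \<forall>a\<in>T. \<forall>b\<in>T. cross2 (a - z) (b - z) \<noteq> 0 \<longrightarrow> 0 < bary z a b y) (nhds z)"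
  proof (intro eventually_ball_finite finC ballI finite_vertices CT)
    fix a b :: pt
    show "eventually (\<lambda>y. cross2 (a - z) (b - z) \<noteq> 0 \<longrightarrow> 0 < bary z a b y) (nhds z)"
    proof (cases "cross2 (a - z) (b - z) = 0")
      case False
      then have "eventually (\<lambda>y. 0 < bary z a b y) (nhds z)"
        by (intro affine_fun_pos_eventually affine_fun_bary) (simp add: bary_vertices)
      then show ?thesis by eventually_elim simp
    qed simp
  qed
  then obtain e where e: "0 < e" and pos: "\<And>y T a b. dist y z < e \<Longrightarrow> T \<in> C \<Longrightarrow> a \<in> T \<Longrightarrow> b \<in> T
      \<Longrightarrow> cross2 (a - z) (b - z) \<noteq> 0 \<Longrightarrow> 0 < bary z a b y"
    unfolding eventually_nhds_metric by blast
  define W where "W = ball z e - {z}"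
  have edge: "y \<in> interior U"
    if T: "T \<in> C" "T = {z, a, b}" "cross2 (a - z) (b - z) \<noteq> 0"
      and y: "y \<in> W" "0 \<le> bary a b z y" "bary b z a y = 0" for T a b y
  proof -
    have za: "z \<noteq> a" using T(3) by (auto simp: cross2_def)
    have sum: "bary z a b y + bary a b z y = 1"
      using bary_sum[OF T(3), of y] y by simp
    have repr: "y = bary z a b y *\<^sub>R z + bary a b z y *\<^sub>R a"
      using bary_repr[OF T(3), of y] y by simp
    have "bary a b z y \<noteq> 0"
    proof
      assume "bary a b z y = 0"
      then have "y = z" using sum repr by simp
      then show False using y by (simp add: W_def)
    qed
    moreover have "0 < bary z a b y"
      using y T by (intro pos) (auto simp: W_def dist_commute)
    moreover have "bary z a b y = 1 - bary a b z y" using sum by simp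
    ultimately have seg: "y \<in> open_segment z a"
      unfolding in_segment using za y repr by (intro conjI exI[of _ "bary a b z y"]) auto
    obtain T' where T': "T' \<in> C" "T' \<noteq> T" "a \<in> T'" using closed[of T a] T za by blast
    have "y \<in> interior (convex hull T \<union> convex hull T')"
      by (rule open_edge_interior[OF _ _ _ za _ _ seg]) (use T T' CT in auto)
    also have "\<dots> \<subseteq> interior U" unfolding U_def using T T' by (intro interior_mono) blast
    finally show ?thesis .
  qed
  \<comment> \<open>A point of the punctured disc in a triangle of \<open>C\<close> has positive
    \<open>z\<close> coordinate. It lies in the interior of that triangle or on an open edge from
    \<open>z\<close>, and the latter was just settled.\<close>
  have WU: "W \<inter> U \<subseteq> interior U"
  proof
    fix y assume y: "y \<in> W \<inter> U"
    then obtain T where T: "T \<in> C" "y \<in> convex hull T" by (auto simp: U_def)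
    obtain a b where ab: "T = {z, a, b}" "cross2 (a - z) (b - z) \<noteq> 0"
      using is_triangleE[OF is_triangle[OF CT(1)[OF T(1)]] CT(2)[OF T(1)]] by metis
    have ge: "0 \<le> bary z a b y" "0 \<le> bary a b z y" "0 \<le> bary b z a y"
      using T in_triangle_iff[OF ab(2)] ab by auto
    consider "bary b z a y = 0" | "bary a b z y = 0" | "0 < bary a b z y" "0 < bary b z a y"
      using ge by linarith
    then show "y \<in> interior U"
    proof cases
      case 1 then show ?thesis using edge[OF T(1) ab] y ge by blast
    next
      case 2
      have "T = {z, b, a}" "cross2 (b - z) (a - z) \<noteq> 0"
        using ab cross2_swap[of "b - z" "a - z"] by auto
      from edge[OF T(1) this] show ?thesis
        using y ge 2 bary_swap[of b z a y] bary_swap[of a b z y] by auto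
    next
      case 3
      have "0 < bary z a b y" using y T ab by (intro pos[of y T]) (auto simp: W_def dist_commute)
      from half_disc_in_triangle[OF ab(2) this 3(1)] affine_fun_pos_eventually[OF affine_fun_bary 3(2)]
      have "eventually (\<lambda>y. y \<in> U) (nhds y)"
        by eventually_elim (use T ab in \<open>auto simp: U_def\<close>)
      then show ?thesis by (rule eventually_nhds_imp_interior)
    qed
  qed
  obtain T where T: "T \<in> C" using C by blast
  obtain a b where ab: "T = {z, a, b}" "z \<noteq> a"
    using is_triangleE[OF is_triangle[OF CT(1)[OF T(1)]] CT(2)[OF T(1)]] by metis
  have "eventually (\<lambda>y. y \<in> ball z e) (nhds z)"
    using e by (intro eventually_nhds_in_open) auto
  then obtain t where t: "0 < t" "t < 1" "z + t *\<^sub>R (a - z) \<in> ball z e"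
    by (rule eventually_nhds_ray)
  have "z + t *\<^sub>R (a - z) \<in> closed_segment z a"
    using t unfolding in_segment by (intro exI[of _ t]) (auto simp: algebra_simps)
  then have "z + t *\<^sub>R (a - z) \<in> convex hull T"
    using hull_mono[of "{z, a}" T convex] ab by (auto simp: segment_convex_hull)
  then have "z + t *\<^sub>R (a - z) \<in> U" unfolding U_def using T by blast
  moreover have "z + t *\<^sub>R (a - z) \<in> W" using t ab by (simp add: W_def)
  ultimately have ne: "interior U \<inter> W \<noteq> {}" using WU by blast
  have "connected W" unfolding W_def by (rule connected_punctured_ball) simp
  moreover have "open (- U)" using clU by (simp add: open_Compl)
  moreover have "interior U \<inter> - U \<inter> W = {}" "W \<subseteq> interior U \<union> - U"
    using interior_subset[of U] WU by blast+
  ultimately have "interior U \<inter> W = {} \<or> - U \<inter> W = {}"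
    using connectedD[of W "interior U" "- U"] by simp
  then have "W \<subseteq> U" using ne by blast
  moreover have "z \<in> U" using T CT hull_inc[of z T convex] by (auto simp: U_def)
  ultimately have "ball z e \<subseteq> U" by (auto simp: W_def)
  then show ?thesis using that e U_def by blast
qed

text \<open>A further triangle at \<open>z\<close> would have interior points near \<open>z\<close>,
  where \<open>C\<close> already covers everything. Such a point lies in the hull of the common
  vertices, and its three positive coordinates make the triangles equal.\<close>

lemma closed_star:
  assumes C: "C \<subseteq> tri_at \<T> z" "C \<noteq> {}"
    and closed: "\<And>T a. T \<in> C \<Longrightarrow> a \<in> T \<Longrightarrow> a \<noteq> z \<Longrightarrow> \<exists>T'\<in>C. T' \<noteq> T \<and> a \<in> T'"
  shows "z \<in> \<Omega>" "C = tri_at \<T> z"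
proof -
  obtain e where e: "0 < e" "ball z e \<subseteq> \<Union> ((\<lambda>T. convex hull T) ` C)"
    using closed_star_covers[OF C closed] by blast
  have "\<Union> ((\<lambda>T. convex hull T) ` C) \<subseteq> closure \<Omega>"
    using C triangle_subset_closure unfolding tri_at_def by blast
  then have "z \<in> interior (closure \<Omega>)" using e by (meson mem_interior order_trans)
  then show "z \<in> \<Omega>" using interior_closure_lipschitz_domain[OF dom] by blast
  show "C = tri_at \<T> z"
  proof (rule ccontr)
    assume "C \<noteq> tri_at \<T> z"
    then obtain T where T: "T \<in> \<T>" "z \<in> T" "T \<notin> C" using C by (auto simp: tri_at_iff)
    obtain a b where ab: "T = {z, a, b}" "cross2 (a - z) (b - z) \<noteq> 0"
      using is_triangleE[OF is_triangle[OF T(1)] T(2)] by metis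
    \<comment> \<open>Points from \<open>z\<close> towards the inside of the triangle: for the step
      t the coordinates are 1 - 2 t / 3, t / 3 and t / 3, all positive.\<close>
    define w where "w = (1/3) *\<^sub>R (a - z) + (1/3) *\<^sub>R (b - z)"
    have "eventually (\<lambda>y. y \<in> ball z e) (nhds z)"
      using e by (intro eventually_nhds_in_open) auto
    then obtain t where t: "0 < t" "t < 1" "z + t *\<^sub>R w \<in> ball z e"
      by (rule eventually_nhds_ray)
    define y where "y = z + t *\<^sub>R w"
    have y: "y = (1 - 2 * t / 3) *\<^sub>R z + (t / 3) *\<^sub>R a + (t / 3) *\<^sub>R b"
      by (simp add: y_def w_def vec_eq_iff) (simp add: field_simps)
    have yC: "y \<in> \<Union> ((\<lambda>T. convex hull T) ` C)" using t e by (auto simp: y_def)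
    then obtain T' where T': "T' \<in> C" "y \<in> convex hull T'" by blast
    then have T'T: "T' \<in> \<T>" "z \<in> T'" "T' \<noteq> T" using C T by (auto simp: tri_at_iff)
    have sum1: "(1 - 2 * t / 3) + t / 3 + t / 3 = 1" by simp
    have D: "cross2 (b - a) (z - a) \<noteq> 0" "cross2 (z - b) (a - b) \<noteq> 0"
      using ab(2) cross2_rotate[of b a z] cross2_rotate[of z b a] by simp_all
    have pos: "0 < bary z a b y" "0 < bary a b z y" "0 < bary b z a y"
      unfolding y affine_fun_comb3[OF affine_fun_bary sum1]
      using t bary_vertices[OF ab(2)] bary_vertices[OF D(1)] bary_vertices[OF D(2)] by simp_all
    then have "y \<in> convex hull T" using in_triangle_iff[OF ab(2), of y] ab(1) by simp
    then have yi: "y \<in> convex hull (T \<inter> T')" using T' triangles_Int[OF T(1) T'T(1)] T'T by blast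
    have "a \<in> T \<inter> T'"
      by (rule bary_pos_imp_vertex[OF D(1) _ yi pos(2)]) (use ab in auto)
    moreover have "b \<in> T \<inter> T'"
      by (rule bary_pos_imp_vertex[OF D(2) _ yi pos(3)]) (use ab in auto)
    ultimately have "T \<subseteq> T'" using ab T'T by auto
    moreover have "card T = 3" "card T' = 3" using is_triangle T T'T by (auto simp: is_triangle_def)
    ultimately have "T = T'" using finite_vertices[OF T'T(1)] by (simp add: card_subset_eq)
    then show False using T'T by simp
  qed
qed

lemma interior_star_closed:
  assumes "z \<in> \<Omega>" "T \<in> tri_at \<T> z" "a \<in> T" "a \<noteq> z"
  shows "\<exists>T'\<in>tri_at \<T> z. T' \<noteq> T \<and> a \<in> T'"
proof -
  have "open \<Omega>" using dom by (simp add: lipschitz_domain_def)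
  then have "eventually (\<lambda>y. y \<in> \<Omega>) (nhds z)"
    using assms by (intro eventually_nhds_in_open) auto
  then obtain t where t: "0 < t" "t < 1" "z + t *\<^sub>R (a - z) \<in> \<Omega>"
    by (rule eventually_nhds_ray)
  have "z + t *\<^sub>R (a - z) \<in> open_segment z a"
    using t assms unfolding in_segment by (intro conjI exI[of _ t]) (auto simp: algebra_simps)
  then show ?thesis
    using edge_neighbour_exists[of T z a, OF _ _ _ _ t(3)] assms by (auto simp: tri_at_iff)
qed

text \<open>A cycle is closed under passing to neighbours, hence is the whole star; connectedness of
  the link comes out as a consequence. The vertices are enumerated periodically over all naturals,
  so the closing edge is no special case.\<close>

lemma link_cycle:
  fixes c :: "nat \<Rightarrow> pt" and z :: pt
  defines "F \<equiv> \<lambda>i. {z, c i, c (Suc i)}"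
  assumes n: "3 \<le> n" and c: "\<And>i j. c i = c j \<longleftrightarrow> i mod n = j mod n" "\<And>i. c i \<noteq> z"
    and F: "\<And>i. F i \<in> tri_at \<T> z"
  shows "z \<in> \<Omega>" "tri_at \<T> z = F ` {..<n}" "inj_on F {..<n}"
proof -
  have ne: "c i \<noteq> c (Suc i)" "c i \<noteq> c (Suc (Suc i))" for i
    using c add_mod_neq[of 1 n i] add_mod_neq[of 2 n i] n by auto
  have Fmod: "F (i mod n) = F i" for i
    unfolding F_def using c(1)[of "i mod n" i] c(1)[of "Suc (i mod n)" "Suc i"]
    by (simp add: mod_Suc_eq)
  have rng: "F i \<in> F ` {..<n}" for i
    using Fmod[of i] n by (intro image_eqI[of _ _ "i mod n"]) auto
  have closed: "\<exists>T'\<in>F ` {..<n}. T' \<noteq> T \<and> a \<in> T'" if Ta: "T \<in> F ` {..<n}" "a \<in> T" "a \<noteq> z" for T a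
  proof -
    obtain i where i: "T = F i" using Ta(1) by blast
    have neF: "F i \<noteq> F (Suc i)" for i
      using ne[of i] c(2)[of i] by (auto simp: F_def)
    \<comment> \<open>The predecessor is taken one period later, which also works for index
      0.\<close>
    have prev: "Suc (i + n - 1) = i + n" using n by simp
    have "F (i + n) = F i" using Fmod[of "i + n"] Fmod[of i] by simp
    then have *: "F (Suc i) \<noteq> F i" "F (i + n - 1) \<noteq> F i"
      using neF[of i] neF[of "i + n - 1"] prev by simp_all
    consider "a = c (Suc i)" | "a = c i" using Ta i by (auto simp: F_def)
    then show ?thesis
    proof cases
      case 1
      then show ?thesis using rng[of "Suc i"] * i by (intro bexI[of _ "F (Suc i)"]) (auto simp: F_def)
    next
      case 2
      have "c i = c (Suc (i + n - 1))" using prev c(1)[of i "i + n"] by simp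
      then have "a \<in> F (i + n - 1)" using 2 by (simp add: F_def)
      then show ?thesis using rng[of "i + n - 1"] * i by blast
    qed
  qed
  have sub: "F ` {..<n} \<subseteq> tri_at \<T> z" "F ` {..<n} \<noteq> {}"
    using F n by (auto simp: lessThan_empty_iff)
  show "z \<in> \<Omega>" "tri_at \<T> z = F ` {..<n}"
    using closed_star[OF sub closed] by simp_all
  show "inj_on F {..<n}"
  proof (rule inj_onI)
    fix i j assume ij: "i \<in> {..<n}" "j \<in> {..<n}" "F i = F j"
    have "c i \<in> F j" "c (Suc i) \<in> F j" using ij(3) by (auto simp: F_def)
    \<comment> \<open>Equal triangles share their link edge, possibly reversed. The reversed case
      would identify vertices two steps apart, impossible for a cycle of length at least 3.\<close>
    then consider "c i = c j" | "c i = c (Suc j)" "c (Suc i) = c j"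
      using c(2) ne[of i] by (auto simp: F_def)
    then show "i = j"
    proof cases
      case 1 then show ?thesis using c ij by simp
    next
      case 2
      then have "i mod n = Suc j mod n" by (simp add: c(1))
      then have "Suc i mod n = Suc (Suc j) mod n" by (metis mod_Suc_eq)
      then have "c j = c (Suc (Suc j))" using 2(2) c(1) by metis
      then show ?thesis using ne(2)[of j] by simp
    qed
  qed
qed

end

subsection \<open>Node estimates\<close>

lemma sum_link_edge:
  fixes f :: "pt \<Rightarrow> real"
  assumes "a \<noteq> z" "b \<noteq> z" "a \<noteq> b"
  shows "(\<Sum>x\<in>{z, a, b} - {z}. f x) = f a + f b"
proof -
  have "{z, a, b} - {z} = {a, b}" using assms by auto
  then show ?thesis using assms by simp
qed

lemma sq_diff_le_double:
  fixes y y' d d' :: real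
  assumes "y + d = y' + d'"
  shows "(y' - y)\<^sup>2 \<le> 2 * d\<^sup>2 + 2 * d'\<^sup>2"
proof -
  have "y' - y = d - d'" using assms by simp
  then have "(y' - y)\<^sup>2 = (d - d')\<^sup>2" by simp
  also have "\<dots> = 2 * d\<^sup>2 + 2 * d'\<^sup>2 - (d + d')\<^sup>2"
    by (simp add: power2_eq_square algebra_simps)
  finally show ?thesis by simp
qed

context lipschitz_triangulation
begin

lemma link_degree:
  assumes "{z, x, a} \<in> \<T>" "{z, x, b} \<in> \<T>" "{z, x, c} \<in> \<T>"
    and "z \<noteq> x" "a \<noteq> z" "a \<noteq> x" "b \<noteq> z" "b \<noteq> x" "c \<noteq> z" "c \<noteq> x"
  shows "a = b \<or> a = c \<or> b = c"
proof (rule ccontr)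
  assume *: "\<not> ?thesis"
  then have "{z, x, a} \<noteq> {z, x, b}" "{z, x, a} \<noteq> {z, x, c}" "{z, x, b} \<noteq> {z, x, c}"
    using assms by (auto simp: set_eq_iff)
  then show False
    using edge_at_most_two[of "{z, x, a}" "{z, x, b}" "{z, x, c}" z x] assms by simp
qed

text \<open>The link graph joins the two vertices other than \<open>z\<close> of each triangle in
  \<open>D\<close>; its degree is at most two because an edge belongs to at most two triangles. A
  general \<open>D\<close> instead of the whole star permits splitting off components one by
  one.\<close>

lemma link_component:
  assumes D: "D \<subseteq> tri_at \<T> z" "D \<noteq> {}"
  obtains (cycle) n c where "3 \<le> n" "\<And>i j. c i = c j \<longleftrightarrow> i mod n = j mod n" "\<And>i. c i \<noteq> z"
      "\<And>i. {z, c i, c (Suc i)} \<in> D"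
  | (path) m c where "inj_on c {..Suc m}" "\<And>i. i \<le> Suc m \<Longrightarrow> c i \<noteq> z"
      "\<And>i. i \<le> m \<Longrightarrow> {z, c i, c (Suc i)} \<in> D"
      "\<And>T. T \<in> D \<Longrightarrow> c 0 \<in> T \<Longrightarrow> T = {z, c 0, c 1}"
      "\<And>T. T \<in> D \<Longrightarrow> c (Suc m) \<in> T \<Longrightarrow> T = {z, c m, c (Suc m)}"
proof -
  define adj where "adj = (\<lambda>a b. a \<noteq> b \<and> a \<noteq> z \<and> b \<noteq> z \<and> {z, a, b} \<in> D)"
  have DT: "T \<in> \<T>" "z \<in> T" if "T \<in> D" for T using D that by (auto simp: tri_at_iff)
  have vert: "\<exists>b. T = {z, a, b} \<and> adj a b" if Ta: "T \<in> D" "a \<in> T" "a \<noteq> z" for T a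
  proof -
    obtain b where b: "T = {z, a, b}" "cross2 (a - z) (b - z) \<noteq> 0"
      by (rule edge_apex[OF DT(1)[OF Ta(1)], of z a]) (use Ta DT in auto)
    then have "b \<noteq> z" "b \<noteq> a" by (auto simp: cross2_def)
    then show ?thesis using b Ta by (auto simp: adj_def)
  qed
  obtain T0 where T0: "T0 \<in> D" using D by blast
  obtain x0 y0 where e0: "adj x0 y0"
    using is_triangleE[OF is_triangle[OF DT(1)[OF T0]] DT(2)[OF T0]] vert[OF T0] by (metis insertI1 insertI2)
  have fin: "finite (\<Union> D)"
    using D finite_tri_at finite_vertices DT by (meson finite_Union finite_subset)
  have a1: "x \<in> \<Union> D" if "adj x y" for x y
    using that by (auto simp: adj_def intro!: bexI[of _ "{z, x, y}"])
  have a2: "adj y x" if "adj x y" for x y using that by (auto simp: adj_def insert_commute)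
  have a3: "\<not> adj x x" for x by (simp add: adj_def)
  have a4: "a = b \<or> a = c \<or> b = c" if "adj x a" "adj x b" "adj x c" for x a b c
    by (rule link_degree[of z x]) (use that DT in \<open>auto simp: adj_def\<close>)
  obtain xs where xs: "distinct xs" "2 \<le> length xs"
    and chain: "\<And>i. Suc i < length xs \<Longrightarrow> adj (xs ! i) (xs ! Suc i)"
    and ends: "3 \<le> length xs \<and> adj (last xs) (hd xs) \<or>
     (\<forall>y. adj (xs ! 0) y \<longrightarrow> y = xs ! 1) \<and>
     (\<forall>y. adj (xs ! (length xs - 1)) y \<longrightarrow> y = xs ! (length xs - 2))"
  proof (rule maximal_path_ends[of "\<Union> D" adj x0 y0])
    show "finite (\<Union> D)" by (fact fin)
    show "x \<in> \<Union> D" if "adj x y" for x y using that by (rule a1)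
    show "adj y x" if "adj x y" for x y using that by (rule a2)
    show "\<not> adj x x" for x by (rule a3)
    show "a = b \<or> a = c \<or> b = c" if "adj x a" "adj x b" "adj x c" for x a b c using that by (rule a4)
    show "adj x0 y0" by (fact e0)
  qed (rule that)
  define n where "n = length xs"
  have n2: "2 \<le> n" using xs by (simp add: n_def)
  then have "xs \<noteq> []" by (auto simp: n_def)
  then have hl: "last xs = xs ! (n - 1)" "hd xs = xs ! 0"
    by (simp_all add: n_def last_conv_nth hd_conv_nth)
  have nz: "xs ! i \<noteq> z" if "i < n" for i
  proof (cases "Suc i < n")
    case True then show ?thesis using chain[of i] by (auto simp: adj_def n_def)
  next
    case False
    then have "Suc (i - 1) < n" "Suc (i - 1) = i" using that n2 by auto
    then show ?thesis using chain[of "i - 1"] by (auto simp: adj_def n_def)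
  qed
  from ends show ?thesis
  proof
    assume cyc: "3 \<le> length xs \<and> adj (last xs) (hd xs)"
    define c where "c = (\<lambda>i. xs ! (i mod n))"
    have n0: "0 < n" using n2 by simp
    show ?thesis
    proof (rule cycle[of n c])
      show "3 \<le> n" using cyc by (simp add: n_def)
      show "c i = c j \<longleftrightarrow> i mod n = j mod n" for i j
        unfolding c_def using xs n0 by (simp add: nth_eq_iff_index_eq n_def)
      show "c i \<noteq> z" for i unfolding c_def using nz n0 by simp
      show "{z, c i, c (Suc i)} \<in> D" for i
      proof (cases "Suc (i mod n) < n")
        case True
        then have "c (Suc i) = xs ! Suc (i mod n)" by (simp add: c_def mod_Suc)
        then show ?thesis using chain[of "i mod n"] True by (simp add: c_def adj_def n_def)
      next
        case False
        then have "Suc (i mod n) = n" using n0 by (meson Suc_lessI mod_less_divisor)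
        then have "c (Suc i) = xs ! 0" "i mod n = n - 1" by (auto simp: c_def mod_Suc)
        then show ?thesis using cyc hl by (simp add: c_def adj_def)
      qed
    qed
  next
    assume pth: "(\<forall>y. adj (xs ! 0) y \<longrightarrow> y = xs ! 1) \<and>
     (\<forall>y. adj (xs ! (length xs - 1)) y \<longrightarrow> y = xs ! (length xs - 2))"
    \<comment> \<open>The path has m + 2 vertices and hence m + 1 triangles.\<close>
    define m where "m = n - 2"
    have m: "n = Suc (Suc m)" using n2 by (simp add: m_def)
    show ?thesis
    proof (rule path[of "\<lambda>i. xs ! i" m])
      show "inj_on ((!) xs) {..Suc m}"
        using xs m by (auto simp: n_def inj_on_def nth_eq_iff_index_eq)
      show "xs ! i \<noteq> z" if "i \<le> Suc m" for i using nz that m by simp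
      show "{z, xs ! i, xs ! Suc i} \<in> D" if "i \<le> m" for i
        using chain[of i] that m by (simp add: adj_def n_def)
      show "T = {z, xs ! 0, xs ! 1}" if T: "T \<in> D" "xs ! 0 \<in> T" for T
        using vert[OF T] pth nz[of 0] m by auto
      show "T = {z, xs ! m, xs ! Suc m}" if T: "T \<in> D" "xs ! Suc m \<in> T" for T
      proof -
        obtain b where "T = {z, xs ! Suc m, b}" "adj (xs ! Suc m) b"
          using vert[OF T] nz[of "Suc m"] m by auto
        moreover have "length xs - 1 = Suc m" "length xs - 2 = m" using m by (simp_all add: n_def)
        ultimately show ?thesis using pth by auto
      qed
    qed
  qed
qed

text \<open>In the application \<open>y T + d T a\<close> is a shifted midpoint value, which
  neighbours share. A path is excluded since its end edge would have only one triangle, although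
  every edge at an interior node has two.\<close>

lemma interior_node_estimate:
  fixes y :: "pt set \<Rightarrow> real" and d :: "pt set \<Rightarrow> pt \<Rightarrow> real"
  assumes z: "z \<in> \<Omega>" "tri_at \<T> z \<noteq> {}" and N: "card (tri_at \<T> z) \<le> N"
    and match: "\<And>T T' a. T \<in> tri_at \<T> z \<Longrightarrow> T' \<in> tri_at \<T> z \<Longrightarrow> a \<in> T \<Longrightarrow> a \<in> T' \<Longrightarrow> a \<noteq> z
      \<Longrightarrow> y T + d T a = y T' + d T' a"
    and straddle: "T1 \<in> tri_at \<T> z" "y T1 \<le> 0" "T2 \<in> tri_at \<T> z" "0 \<le> y T2"
  shows "2 * (1 - cos (pi / real N)) * (\<Sum>T\<in>tri_at \<T> z. (y T)\<^sup>2)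
    \<le> 2 * (\<Sum>T\<in>tri_at \<T> z. \<Sum>a\<in>T - {z}. (d T a)\<^sup>2)"
proof (rule link_component[OF subset_refl z(2)])
  fix m c
  assume c: "inj_on c {..Suc m}" "\<And>i. i \<le> Suc m \<Longrightarrow> c i \<noteq> z"
    "\<And>i. i \<le> m \<Longrightarrow> {z, c i, c (Suc i)} \<in> tri_at \<T> z"
    "\<And>T. T \<in> tri_at \<T> z \<Longrightarrow> c 0 \<in> T \<Longrightarrow> T = {z, c 0, c 1}"
  from interior_star_closed[OF z(1) c(3)[of 0], of "c 0"] c(2)[of 0]
  obtain T' where "T' \<in> tri_at \<T> z" "T' \<noteq> {z, c 0, c 1}" "c 0 \<in> T'" by auto
  then show ?thesis using c(4) by blast
next
  fix n c
  assume n: "3 \<le> n" and c: "\<And>i j. c i = c j \<longleftrightarrow> i mod n = j mod n" "\<And>i. c i \<noteq> z"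
    and F: "\<And>i. {z, c i, c (Suc i)} \<in> tri_at \<T> z"
  define G where "G = (\<lambda>i. {z, c i, c (Suc i)})"
  note star = link_cycle[OF n c F, folded G_def]
  have cS: "c i \<noteq> c (Suc i)" for i using c(1) add_mod_neq[of 1 n i] n by simp
  have per: "c (i + n) = c i" for i using c(1) by simp
  have perG: "G (i + n) = G i" for i using per[of i] per[of "Suc i"] by (simp add: G_def)
  have GT: "G i \<in> tri_at \<T> z" for i using F by (simp add: G_def)
  have re: "(\<Sum>T\<in>tri_at \<T> z. f T) = (\<Sum>i<n. f (G i))" for f :: "pt set \<Rightarrow> real"
    unfolding star(2) by (rule sum.reindex[OF star(3), unfolded o_def])
  have nN: "n \<le> N" using N star(2) card_image[OF star(3)] by simp
  obtain i j where ij: "i < n" "y (G i) \<le> 0" "j < n" "0 \<le> y (G j)"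
    using straddle star(2) by auto
  have "2 * (1 - cos (pi / real N)) * (\<Sum>i<n. (y (G i))\<^sup>2) \<le> (\<Sum>i<n. (y (G (Suc i)) - y (G i))\<^sup>2)"
    by (rule cycle_sum_ge[OF _ nN _ ij]) (use n perG in auto)
  also have "\<dots> \<le> (\<Sum>i<n. 2 * (d (G i) (c (Suc i)))\<^sup>2 + 2 * (d (G (Suc i)) (c (Suc i)))\<^sup>2)"
  proof (intro sum_mono sq_diff_le_double)
    fix i
    show "y (G i) + d (G i) (c (Suc i)) = y (G (Suc i)) + d (G (Suc i)) (c (Suc i))"
      using GT c(2) by (intro match) (auto simp: G_def)
  qed
  also have "\<dots> = 2 * ((\<Sum>i<n. (d (G i) (c (Suc i)))\<^sup>2) + (\<Sum>i<n. (d (G (Suc i)) (c (Suc i)))\<^sup>2))"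
    by (simp add: sum.distrib sum_distrib_left)
  \<comment> \<open>Shifting the index by one gives each triangle the terms of both its edges at
    \<open>z\<close>.\<close>
  also have "(\<Sum>i<n. (d (G (Suc i)) (c (Suc i)))\<^sup>2) = (\<Sum>i<n. (d (G i) (c i))\<^sup>2)"
    using sum_periodic_shift[of "\<lambda>i. (d (G i) (c i))\<^sup>2" n 1] per perG by simp
  also have "(\<Sum>i<n. (d (G i) (c (Suc i)))\<^sup>2) + (\<Sum>i<n. (d (G i) (c i))\<^sup>2)
     = (\<Sum>i<n. \<Sum>a\<in>G i - {z}. (d (G i) a)\<^sup>2)"
  proof -
    have "(\<Sum>a\<in>G i - {z}. (d (G i) a)\<^sup>2) = (d (G i) (c i))\<^sup>2 + (d (G i) (c (Suc i)))\<^sup>2" for i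
      unfolding G_def by (rule sum_link_edge[OF c(2) c(2) cS])
    then show ?thesis by (simp add: sum.distrib)
  qed
  finally show ?thesis unfolding re .
qed

text \<open>The end conditions say y = - d on the two outer edges, so the doubled end terms
  contribute exactly the weight 2 that the inner edges contribute per triangle.\<close>

lemma boundary_path_estimate:
  fixes y :: "pt set \<Rightarrow> real" and d :: "pt set \<Rightarrow> pt \<Rightarrow> real" and c :: "nat \<Rightarrow> pt" and z :: pt
  assumes N: "Suc m \<le> N" and G: "\<And>i. G i = {z, c i, c (Suc i)}" and c: "inj_on c {..Suc m}" "\<And>i. i \<le> Suc m \<Longrightarrow> c i \<noteq> z"
    and match: "\<And>i. i < m \<Longrightarrow> y (G i) + d (G i) (c (Suc i)) = y (G (Suc i)) + d (G (Suc i)) (c (Suc i))"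
    and bd: "y (G 0) + d (G 0) (c 0) = 0" "y (G m) + d (G m) (c (Suc m)) = 0"
  shows "2 * (1 - cos (pi / real N)) * (\<Sum>i\<le>m. (y (G i))\<^sup>2)
    \<le> 2 * (\<Sum>i\<le>m. \<Sum>a\<in>G i - {z}. (d (G i) a)\<^sup>2)"
proof -
  have "2 * (1 - cos (pi / real N)) * (\<Sum>i\<le>m. (y (G i))\<^sup>2)
    \<le> 2 * (y (G 0))\<^sup>2 + (\<Sum>i<m. (y (G (Suc i)) - y (G i))\<^sup>2) + 2 * (y (G m))\<^sup>2"
    by (rule path_half_step_dirichlet_sum_ge) (use N in simp)
  also have "y (G 0) = - d (G 0) (c 0)" using bd(1) by simp
  also have "y (G m) = - d (G m) (c (Suc m))" using bd(2) by simp
  also have "(\<Sum>i<m. (y (G (Suc i)) - y (G i))\<^sup>2)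
     \<le> (\<Sum>i<m. 2 * (d (G i) (c (Suc i)))\<^sup>2 + 2 * (d (G (Suc i)) (c (Suc i)))\<^sup>2)"
    by (intro sum_mono sq_diff_le_double) (use match in auto)
  also have "2 * (- d (G 0) (c 0))\<^sup>2 + \<dots> + 2 * (- d (G m) (c (Suc m)))\<^sup>2
    = 2 * (((d (G 0) (c 0))\<^sup>2 + (\<Sum>i<m. (d (G (Suc i)) (c (Suc i)))\<^sup>2))
       + ((\<Sum>i<m. (d (G i) (c (Suc i)))\<^sup>2) + (d (G m) (c (Suc m)))\<^sup>2))"
    by (simp add: sum.distrib sum_distrib_left)
  also have "(d (G 0) (c 0))\<^sup>2 + (\<Sum>i<m. (d (G (Suc i)) (c (Suc i)))\<^sup>2) = (\<Sum>i\<le>m. (d (G i) (c i))\<^sup>2)"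
    by (simp add: sum.atMost_shift)
  also have "(\<Sum>i<m. (d (G i) (c (Suc i)))\<^sup>2) + (d (G m) (c (Suc m)))\<^sup>2 = (\<Sum>i\<le>m. (d (G i) (c (Suc i)))\<^sup>2)"
    by (simp flip: lessThan_Suc_atMost)
  also have "(\<Sum>i\<le>m. (d (G i) (c i))\<^sup>2) + (\<Sum>i\<le>m. (d (G i) (c (Suc i)))\<^sup>2)
     = (\<Sum>i\<le>m. \<Sum>a\<in>G i - {z}. (d (G i) a)\<^sup>2)"
    unfolding sum.distrib[symmetric]
  proof (intro sum.cong refl)
    fix i assume "i \<in> {..m}"
    then have "c i \<noteq> c (Suc i)" "c i \<noteq> z" "c (Suc i) \<noteq> z"
      using c inj_onD[OF c(1), of i "Suc i"] by auto
    then show "(d (G i) (c i))\<^sup>2 + (d (G i) (c (Suc i)))\<^sup>2 = (\<Sum>a\<in>G i - {z}. (d (G i) a)\<^sup>2)"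
      unfolding G by (intro sum_link_edge[symmetric])
  qed
  finally show ?thesis by simp
qed

text \<open>The link of a boundary node need not be connected a priori; its components are split off one
  at a time.\<close>
lemma boundary_node_estimate_aux:
  fixes y :: "pt set \<Rightarrow> real" and d :: "pt set \<Rightarrow> pt \<Rightarrow> real"
  assumes z: "z \<notin> \<Omega>" and N: "card (tri_at \<T> z) \<le> N"
    and match: "\<And>T T' a. T \<in> tri_at \<T> z \<Longrightarrow> T' \<in> tri_at \<T> z \<Longrightarrow> a \<in> T \<Longrightarrow> a \<in> T' \<Longrightarrow> a \<noteq> z
      \<Longrightarrow> y T + d T a = y T' + d T' a"
    and bd: "\<And>T a. T \<in> tri_at \<T> z \<Longrightarrow> a \<in> T \<Longrightarrow> a \<noteq> z \<Longrightarrow>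
      (\<And>T'. T' \<in> tri_at \<T> z \<Longrightarrow> a \<in> T' \<Longrightarrow> T' = T) \<Longrightarrow> y T + d T a = 0"
  shows "finite D \<Longrightarrow> D \<subseteq> tri_at \<T> z \<Longrightarrow>
      (\<And>T T' a. T \<in> D \<Longrightarrow> T' \<in> tri_at \<T> z \<Longrightarrow> a \<in> T \<Longrightarrow> a \<in> T' \<Longrightarrow> a \<noteq> z \<Longrightarrow> T' \<in> D) \<Longrightarrow>
    2 * (1 - cos (pi / real N)) * (\<Sum>T\<in>D. (y T)\<^sup>2) \<le> 2 * (\<Sum>T\<in>D. \<Sum>a\<in>T - {z}. (d T a)\<^sup>2)"
proof (induction D rule: finite_psubset_induct)
  case (psubset D)
  note Dsub = psubset.prems(1) and Dadj = psubset.prems(2)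
  show ?case
  proof (cases "D = {}")
    case False
    show ?thesis
    proof (rule link_component[OF Dsub False])
      fix n c
      assume "3 \<le> n" "\<And>i j. c i = c j \<longleftrightarrow> i mod n = j mod n" "\<And>i. c i \<noteq> z"
        "\<And>i. {z, c i, c (Suc i)} \<in> D"
      then have "z \<in> \<Omega>" using link_cycle(1)[of n c z] Dsub by blast
      then show ?thesis using z by blast
    next
      fix m c
      assume c: "inj_on c {..Suc m}" "\<And>i. i \<le> Suc m \<Longrightarrow> c i \<noteq> z"
        and F: "\<And>i. i \<le> m \<Longrightarrow> {z, c i, c (Suc i)} \<in> D"
        and first: "\<And>T. T \<in> D \<Longrightarrow> c 0 \<in> T \<Longrightarrow> T = {z, c 0, c 1}"
        and last: "\<And>T. T \<in> D \<Longrightarrow> c (Suc m) \<in> T \<Longrightarrow> T = {z, c m, c (Suc m)}"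
      define G where "G = (\<lambda>i. {z, c i, c (Suc i)})"
      have GD: "G i \<in> D" "G i \<in> tri_at \<T> z" if "i \<le> m" for i using F that Dsub by (auto simp: G_def)
      have ceq: "c i = c j \<longleftrightarrow> i = j" if "i \<le> Suc m" "j \<le> Suc m" for i j
        using c(1) that by (auto simp: inj_on_def)
      have inj: "inj_on G {..m}"
      proof (rule inj_onI)
        fix i j assume ij: "i \<in> {..m}" "j \<in> {..m}" "G i = G j"
        have "c i \<in> G j" "c (Suc i) \<in> G j" using ij(3) by (auto simp: G_def)
        then have "(i = j \<or> i = Suc j) \<and> (Suc i = j \<or> Suc i = Suc j)"
          using ij c(2) ceq by (auto simp: G_def)
        then show "i = j" by auto
      qed
      define P where "P = G ` {..m}"
      have PD: "P \<subseteq> D" "P \<noteq> {}" using GD by (auto simp: P_def)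
      have re: "(\<Sum>T\<in>P. f T) = (\<Sum>i\<le>m. f (G i))" for f :: "pt set \<Rightarrow> real"
        unfolding P_def by (rule sum.reindex[OF inj, unfolded o_def])
      have "card P = Suc m" unfolding P_def by (simp add: card_image[OF inj])
      moreover have "card P \<le> card (tri_at \<T> z)"
        using PD Dsub finite_tri_at by (intro card_mono) auto
      ultimately have mN: "Suc m \<le> N" using N by simp
      have "2 * (1 - cos (pi / real N)) * (\<Sum>i\<le>m. (y (G i))\<^sup>2)
          \<le> 2 * (\<Sum>i\<le>m. \<Sum>a\<in>G i - {z}. (d (G i) a)\<^sup>2)"
      proof (rule boundary_path_estimate[OF mN, where c = c])
        show "G i = {z, c i, c (Suc i)}" for i by (simp add: G_def)
        show "inj_on c {..Suc m}" by (fact c(1))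
        show "c i \<noteq> z" if "i \<le> Suc m" for i using that by (rule c(2))
        show "y (G i) + d (G i) (c (Suc i)) = y (G (Suc i)) + d (G (Suc i)) (c (Suc i))" if "i < m" for i
          using GD[of i] GD[of "Suc i"] c(2) that by (intro match) (auto simp: G_def)
        \<comment> \<open>The path end is known to lie in one triangle of \<open>D\<close> only;
          closedness of \<open>D\<close> under adjacency extends this to the whole star, as the
          boundary condition requires.\<close>
        show "y (G 0) + d (G 0) (c 0) = 0"
        proof (rule bd)
          fix T' assume "T' \<in> tri_at \<T> z" "c 0 \<in> T'"
          then have "T' \<in> D" using Dadj[of "G 0" T' "c 0"] GD[of 0] c(2)[of 0] by (auto simp: G_def)
          then show "T' = G 0" using first \<open>c 0 \<in> T'\<close> by (simp add: G_def)
        qed (use GD[of 0] c(2)[of 0] in \<open>auto simp: G_def\<close>)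
        show "y (G m) + d (G m) (c (Suc m)) = 0"
        proof (rule bd)
          fix T' assume "T' \<in> tri_at \<T> z" "c (Suc m) \<in> T'"
          then have "T' \<in> D" using Dadj[of "G m" T' "c (Suc m)"] GD[of m] c(2)[of "Suc m"] by (auto simp: G_def)
          then show "T' = G m" using last \<open>c (Suc m) \<in> T'\<close> by (simp add: G_def)
        qed (use GD[of m] c(2)[of "Suc m"] in \<open>auto simp: G_def\<close>)
      qed
      then have 1: "2 * (1 - cos (pi / real N)) * (\<Sum>T\<in>P. (y T)\<^sup>2)
          \<le> 2 * (\<Sum>T\<in>P. \<Sum>a\<in>T - {z}. (d T a)\<^sup>2)" unfolding re .
      \<comment> \<open>At the ends of the path there is only one triangle of \<open>D\<close>; an
        inner vertex already has its two path triangles, the maximum for an edge. Hence removing the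
        path leaves a set that is still closed under adjacency.\<close>
      have inP: "T \<in> P" if T: "T \<in> D" and k: "k \<le> Suc m" "c k \<in> T" for T k
      proof -
        consider "k = 0" | "k = Suc m" | l where "k = Suc l" "Suc l \<le> m"
          using k by (cases k) (auto simp: le_Suc_eq)
        then show ?thesis
        proof cases
          case 1 then show ?thesis using first[OF T] k by (auto simp: P_def G_def intro!: image_eqI[of _ _ 0])
        next
          case 2 then show ?thesis using last[OF T] k by (auto simp: P_def G_def intro!: image_eqI[of _ _ m])
        next
          case 3
          have Tz: "T \<in> \<T>" "z \<in> T" using T Dsub by (auto simp: tri_at_iff)
          have kz: "z \<noteq> c k" using c(2)[OF k(1)] by simp
          have ne: "G l \<noteq> G k" using inj_onD[OF inj, of l k] 3 by auto
          have Gk: "G l \<in> \<T>" "G k \<in> \<T>" using GD[of l] GD[of k] 3 by (auto simp: tri_at_iff)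
          have "T = G l \<or> T = G k"
            using edge_at_most_two[OF Tz(1) Gk(1) Gk(2) _ _ kz] ne Tz k 3 by (auto simp: G_def)
          then show ?thesis using 3 by (auto simp: P_def)
        qed
      qed
      have 2: "2 * (1 - cos (pi / real N)) * (\<Sum>T\<in>D - P. (y T)\<^sup>2)
          \<le> 2 * (\<Sum>T\<in>D - P. \<Sum>a\<in>T - {z}. (d T a)\<^sup>2)"
      proof (rule psubset.IH)
        show "D - P \<subset> D" using PD by blast
        show "D - P \<subseteq> tri_at \<T> z" using Dsub by blast
        fix T T' a assume *: "T \<in> D - P" "T' \<in> tri_at \<T> z" "a \<in> T" "a \<in> T'" "a \<noteq> z"
        have "T' \<notin> P"
        proof
          assume "T' \<in> P"
          then obtain i where "i \<le> m" "a = c i \<or> a = c (Suc i)" using * by (auto simp: P_def G_def)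
          then have "T \<in> P" using inP[of T i] inP[of T "Suc i"] * by auto
          then show False using * by blast
        qed
        then show "T' \<in> D - P" using Dadj * by blast
      qed
      have split: "(\<Sum>T\<in>D. f T) = (\<Sum>T\<in>D - P. f T) + (\<Sum>T\<in>P. f T)" for f :: "pt set \<Rightarrow> real"
        using sum.subset_diff[OF PD(1) psubset.hyps(1)] .
      show ?thesis unfolding split using 1 2 by (simp add: distrib_left)
    qed
  qed simp
qed

lemma boundary_node_estimate:
  fixes y :: "pt set \<Rightarrow> real" and d :: "pt set \<Rightarrow> pt \<Rightarrow> real"
  assumes z: "z \<notin> \<Omega>" and N: "card (tri_at \<T> z) \<le> N"
    and match: "\<And>T T' a. T \<in> tri_at \<T> z \<Longrightarrow> T' \<in> tri_at \<T> z \<Longrightarrow> a \<in> T \<Longrightarrow> a \<in> T' \<Longrightarrow> a \<noteq> z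
      \<Longrightarrow> y T + d T a = y T' + d T' a"
    and bd: "\<And>T a. T \<in> tri_at \<T> z \<Longrightarrow> a \<in> T \<Longrightarrow> a \<noteq> z \<Longrightarrow>
      (\<And>T'. T' \<in> tri_at \<T> z \<Longrightarrow> a \<in> T' \<Longrightarrow> T' = T) \<Longrightarrow> y T + d T a = 0"
  shows "2 * (1 - cos (pi / real N)) * (\<Sum>T\<in>tri_at \<T> z. (y T)\<^sup>2)
    \<le> 2 * (\<Sum>T\<in>tri_at \<T> z. \<Sum>a\<in>T - {z}. (d T a)\<^sup>2)"
proof (rule boundary_node_estimate_aux[OF z N, where y = y and d = d])
  show "y T + d T a = y T' + d T' a"
    if "T \<in> tri_at \<T> z" "T' \<in> tri_at \<T> z" "a \<in> T" "a \<in> T'" "a \<noteq> z" for T T' a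
    using that by (rule match)
  show "y T + d T a = 0"
    if "T \<in> tri_at \<T> z" "a \<in> T" "a \<noteq> z" "\<And>T'. T' \<in> tri_at \<T> z \<Longrightarrow> a \<in> T' \<Longrightarrow> T' = T" for T a
    using that by (rule bd)
qed (auto simp: finite_tri_at)

end

subsection \<open>Integrals over triangles and angle bounds\<close>

lemma absolutely_integrable_on_compact:
  fixes f :: "pt \<Rightarrow> real"
  assumes "compact S" "continuous_on S f"
  shows "f absolutely_integrable_on S"
proof -
  have m: "S \<in> lmeasurable" using assms(1) by (rule lmeasurable_compact)
  obtain B where B: "\<And>x. x \<in> S \<Longrightarrow> norm (f x) \<le> B"
    using compact_imp_bounded[OF compact_continuous_image[OF assms(2,1)]] by (auto simp: bounded_iff)
  show ?thesis
  proof (rule measurable_bounded_by_integrable_imp_absolutely_integrable)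
    show "f \<in> borel_measurable (lebesgue_on S)"
      using assms(2) m by (intro continuous_imp_measurable_on_sets_lebesgue) auto
    show "S \<in> sets lebesgue" using m by auto
    show "(\<lambda>x. B) integrable_on S" using m by (rule integrable_on_const)
  qed (use B in auto)
qed

lemma content_triangle_cross2:
  "measure lborel (convex hull {p, q, r}) = \<bar>cross2 (q - p) (r - p)\<bar> / 2"
  unfolding content_triangle cross2_def by (simp add: abs_minus_commute algebra_simps)

lemma integral_triangle_const:
  fixes k :: real
  shows "integral (convex hull {p, q, r :: pt}) (\<lambda>x. k) = k * measure lborel (convex hull {p, q, r})"
proof -
  have c: "compact (convex hull {p, q, r})" by (simp add: finite_imp_compact_convex_hull)
  have "integral (convex hull {p, q, r}) (\<lambda>x. k * 1) = k * integral (convex hull {p, q, r}) (\<lambda>x. 1)"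
    by (rule integral_mult_right)
  also have "integral (convex hull {p, q, r}) (\<lambda>x. 1 :: real) = measure lebesgue (convex hull {p, q, r})"
    using lmeasurable_compact[OF c] by (simp add: lmeasure_integral)
  also have "\<dots> = measure lborel (convex hull {p, q, r})"
    using c by (simp add: measure_completion borel_compact)
  finally show ?thesis by simp
qed

text \<open>The affine map exchanging \<^term>\<open>p\<close> and \<^term>\<open>q\<close> and fixing \<^term>\<open>r\<close> preserves area.\<close>
lemma integral_bary_swap:
  assumes D: "cross2 (q - p) (r - p) \<noteq> 0"
  shows "integral (convex hull {p, q, r}) (bary p q r) = integral (convex hull {p, q, r}) (bary q r p)"
proof -
  define H where "H = convex hull {p, q, r}"
  define g where "g = (\<lambda>x. x + (bary p q r x - bary q r p x) *\<^sub>R (q - p))"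
  obtain b c where b: "\<And>x. bary p q r x = b \<bullet> x + c"
    using affine_fun_bary[of p q r] unfolding affine_fun_def by blast
  obtain b' c' where b': "\<And>x. bary q r p x = b' \<bullet> x + c'"
    using affine_fun_bary[of q r p] unfolding affine_fun_def by blast
  obtain b'' c'' where b'': "\<And>x. bary r p q x = b'' \<bullet> x + c''"
    using affine_fun_bary[of r p q] unfolding affine_fun_def by blast
  have D': "cross2 (r - q) (p - q) \<noteq> 0" "cross2 (p - r) (q - r) \<noteq> 0"
    using D cross2_rotate[of p r q] cross2_rotate[of r q p] by simp_all
  have w: "b \<bullet> (q - p) = -1" "b' \<bullet> (q - p) = 1" "b'' \<bullet> (q - p) = 0"
    using bary_vertices[OF D] bary_vertices[OF D'(1)] bary_vertices[OF D'(2)]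
    unfolding b b' b'' by (simp_all add: inner_diff_right)
  have bg: "bary p q r (g x) = bary q r p x" "bary q r p (g x) = bary p q r x"
    "bary r p q (g x) = bary r p q x" for x
  proof -
    have "bary p q r (g x) = bary p q r x + (bary p q r x - bary q r p x) * (b \<bullet> (q - p))"
      unfolding b g_def by (simp add: inner_add_right algebra_simps)
    then show "bary p q r (g x) = bary q r p x" using w by simp
    have "bary q r p (g x) = bary q r p x + (bary p q r x - bary q r p x) * (b' \<bullet> (q - p))"
      unfolding b' g_def by (simp add: inner_add_right algebra_simps)
    then show "bary q r p (g x) = bary p q r x" using w by simp
    have "bary r p q (g x) = bary r p q x + (bary p q r x - bary q r p x) * (b'' \<bullet> (q - p))"
      unfolding b'' g_def by (simp add: inner_add_right algebra_simps)
    then show "bary r p q (g x) = bary r p q x" using w by simp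
  qed
  have gg: "g (g x) = x" for x
  proof -
    have "g (g x) = g x + (bary q r p x - bary p q r x) *\<^sub>R (q - p)"
      using bg[of x] by (subst (1) g_def) simp
    then show ?thesis unfolding g_def by (simp add: algebra_simps)
  qed
  have gH: "g x \<in> H" if "x \<in> H" for x
    using that bg[of x] unfolding H_def in_triangle_iff[OF D] by simp
  have img: "g ` H = H"
  proof
    show "g ` H \<subseteq> H" using gH by blast
    show "H \<subseteq> g ` H" using gH gg by (metis image_eqI subsetI)
  qed
  define \<mu> where "\<mu> = b - b'"
  define g' where "g' = (\<lambda>h. h + (\<mu> \<bullet> h) *\<^sub>R (q - p))"
  have g_eq: "g = (\<lambda>x. x + (\<mu> \<bullet> x + (c - c')) *\<^sub>R (q - p))"
    unfolding g_def b b' \<mu>_def by (simp add: inner_diff_left algebra_simps)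
  have der: "(g has_derivative g') (at x within H)" for x
    unfolding g_eq g'_def by (auto intro!: derivative_eq_intros)
  \<comment> \<open>A rank-one perturbation of the identity; its determinant is -1 since the map is
    an oblique reflection.\<close>
  have "det (matrix g') = 1 + \<mu> \<bullet> (q - p)"
    unfolding det_2 matrix_def g'_def
    by (simp add: inner_axis inner_vec_def sum_2 axis_def algebra_simps)
  also have "\<dots> = -1" using w by (simp add: \<mu>_def inner_diff_left)
  finally have det: "\<bar>det (matrix g')\<bar> = 1" by simp
  have cH: "compact H" unfolding H_def by (simp add: finite_imp_compact_convex_hull)
  define f where "f = (\<lambda>x. vec (bary p q r x) :: real^1)"
  have ai: "f absolutely_integrable_on H"
    unfolding f_def absolutely_integrable_on_1_iff
    using absolutely_integrable_on_compact[OF cH affine_fun_continuous[OF affine_fun_bary]] by simp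
  have "integral (g ` H) f = integral H (\<lambda>x. \<bar>det (matrix g')\<bar> *\<^sub>R f (g x))"
  proof (rule integral_change_of_variables)
    show "H \<in> sets lebesgue" using lmeasurable_compact[OF cH] by auto
    show "inj_on g H" using gg by (metis inj_on_inverseI)
    show "f absolutely_integrable_on g ` H \<or>
      (\<lambda>x. \<bar>det (matrix g')\<bar> *\<^sub>R f (g x)) absolutely_integrable_on H"
      using ai img by simp
  qed (rule der)
  then have "integral H f $ 1 = integral H (\<lambda>x. f (g x)) $ 1" using img det by simp
  then show ?thesis
    unfolding f_def bg integral_on_1_eq by (simp add: H_def)
qed

text \<open>Swapping vertices makes the three integrals equal, and the coordinates sum to 1.\<close>

lemma integral_bary:
  assumes D: "cross2 (q - p) (r - p) \<noteq> 0"
  shows "integral (convex hull {p, q, r}) (bary p q r) = measure lborel (convex hull {p, q, r}) / 3"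
    and "integral (convex hull {p, q, r}) (bary q r p) = measure lborel (convex hull {p, q, r}) / 3"
    and "integral (convex hull {p, q, r}) (bary r p q) = measure lborel (convex hull {p, q, r}) / 3"
proof -
  define H where "H = convex hull {p, q, r}"
  have D': "cross2 (r - q) (p - q) \<noteq> 0"
    using D cross2_rotate[of r q p] by simp
  have rot: "{q, r, p} = {p, q, r}" by auto
  have 1: "integral H (bary p q r) = integral H (bary q r p)"
    unfolding H_def by (rule integral_bary_swap[OF D])
  have 2: "integral H (bary q r p) = integral H (bary r p q)"
    unfolding H_def using integral_bary_swap[OF D'] rot by simp
  have cH: "compact H" unfolding H_def by (simp add: finite_imp_compact_convex_hull)
  have int: "bary a b c integrable_on H" for a b c
    using absolutely_integrable_on_compact[OF cH affine_fun_continuous[OF affine_fun_bary]]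
    by (rule set_lebesgue_integral_eq_integral(1))
  have "integral H (\<lambda>x. bary p q r x + bary q r p x + bary r p q x)
     = integral H (bary p q r) + integral H (bary q r p) + integral H (bary r p q)"
    by (simp add: integral_add int integrable_add)
  then have "integral H (bary p q r) + integral H (bary q r p) + integral H (bary r p q) = measure lborel H"
    using integral_triangle_const[of p q r 1] bary_sum[OF D] by (simp add: H_def)
  then show "integral (convex hull {p, q, r}) (bary p q r) = measure lborel (convex hull {p, q, r}) / 3"
    and "integral (convex hull {p, q, r}) (bary q r p) = measure lborel (convex hull {p, q, r}) / 3"
    and "integral (convex hull {p, q, r}) (bary r p q) = measure lborel (convex hull {p, q, r}) / 3"
    using 1 2 unfolding H_def by simp_all
qed

section \<open>Vertex values, area and angles of a triangle\<close>

lemma square_convex_comb3: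
  fixes u v w a b c :: real
  assumes "0 \<le> u" "0 \<le> v" "0 \<le> w" "u + v + w = 1"
  shows "(u * a + v * b + w * c)\<^sup>2 \<le> u * a\<^sup>2 + v * b\<^sup>2 + w * c\<^sup>2"
proof -
  have u: "u = 1 - v - w" using assms by simp
  have "u * a\<^sup>2 + v * b\<^sup>2 + w * c\<^sup>2 - (u * a + v * b + w * c)\<^sup>2
     = u * v * (a - b)\<^sup>2 + v * w * (b - c)\<^sup>2 + u * w * (a - c)\<^sup>2"
    unfolding u by (simp add: power2_eq_square algebra_simps)
  also have "\<dots> \<ge> 0" using assms by simp
  finally show ?thesis by simp
qed

text \<open>Jensen's inequality in barycentric coordinates, each of which integrates to a third of
  the area. Constant functions attain the bound.\<close>

lemma integral_affine_sq_triangle_le: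
  assumes D: "cross2 (q - p) (r - p) \<noteq> 0" and f: "affine_fun f"
  shows "integral (convex hull {p, q, r}) (\<lambda>x. (f x)\<^sup>2)
    \<le> measure lborel (convex hull {p, q, r}) / 3 * ((f p)\<^sup>2 + (f q)\<^sup>2 + (f r)\<^sup>2)"
proof -
  define H where "H = convex hull {p, q, r}"
  have cH: "compact H" unfolding H_def by (simp add: finite_imp_compact_convex_hull)
  have int: "h integrable_on H" if "continuous_on H h" for h :: "pt \<Rightarrow> real"
    using absolutely_integrable_on_compact[OF cH that]
    by (rule set_lebesgue_integral_eq_integral(1))
  have cb: "continuous_on H (bary a b c)" for a b c by (rule affine_fun_continuous[OF affine_fun_bary])
  have "integral H (\<lambda>x. (f x)\<^sup>2) \<le> integral H (\<lambda>x. bary p q r x * (f p)\<^sup>2 + bary q r p x * (f q)\<^sup>2 + bary r p q x * (f r)\<^sup>2)"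
  proof (rule integral_le)
    show "(\<lambda>x. (f x)\<^sup>2) integrable_on H"
      by (intro int continuous_intros affine_fun_continuous[OF f])
    show "(\<lambda>x. bary p q r x * (f p)\<^sup>2 + bary q r p x * (f q)\<^sup>2 + bary r p q x * (f r)\<^sup>2) integrable_on H"
      by (intro int continuous_intros cb)
    fix x assume "x \<in> H"
    then have ge: "0 \<le> bary p q r x" "0 \<le> bary q r p x" "0 \<le> bary r p q x"
      unfolding H_def in_triangle_iff[OF D] by auto
    have "f x = bary p q r x * f p + bary q r p x * f q + bary r p q x * f r"
      using affine_fun_comb3[OF f bary_sum[OF D, of x], of p q r] bary_repr[OF D, of x] by simp
    then show "(f x)\<^sup>2 \<le> bary p q r x * (f p)\<^sup>2 + bary q r p x * (f q)\<^sup>2 + bary r p q x * (f r)\<^sup>2"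
      using square_convex_comb3[OF ge bary_sum[OF D]] by simp
  qed
  also have "\<dots> = integral H (bary p q r) * (f p)\<^sup>2 + integral H (bary q r p) * (f q)\<^sup>2 + integral H (bary r p q) * (f r)\<^sup>2"
    by (simp add: integral_add integrable_add integrable_on_mult_left int cb)
  also have "\<dots> = measure lborel H / 3 * ((f p)\<^sup>2 + (f q)\<^sup>2 + (f r)\<^sup>2)"
    unfolding H_def integral_bary[OF D] by (simp add: algebra_simps)
  finally show ?thesis by (simp add: H_def)
qed

text \<open>Heron's formula in squared sides, 16 |T|^2 = 4 A B - (A + B - C)^2; the equilateral
  triangle is extremal.\<close>

lemma content_triangle_le_diameter:
  fixes p q r :: pt
  assumes "norm (q - p) \<le> h" "norm (r - p) \<le> h" "norm (r - q) \<le> h"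
  shows "measure lborel (convex hull {p, q, r}) \<le> sqrt 3 / 4 * h\<^sup>2"
proof -
  define A B C where "A = (norm (q - p))\<^sup>2" and "B = (norm (r - p))\<^sup>2" and "C = (norm (r - q))\<^sup>2"
  have le: "A \<le> h\<^sup>2" "B \<le> h\<^sup>2" "C \<le> h\<^sup>2"
    using assms by (auto simp: A_def B_def C_def intro!: power_mono)
  have "r - q = (r - p) - (q - p)" by simp
  then have "C = A + B - 2 * ((q - p) \<bullet> (r - p))"
    unfolding A_def B_def C_def power2_norm_eq_inner by (simp add: inner_diff_left inner_diff_right inner_commute algebra_simps)
  then have "(A + B - C)\<^sup>2 = 4 * ((q - p) \<bullet> (r - p))\<^sup>2" by (simp add: power_mult_distrib)
  moreover have "(cross2 (q - p) (r - p))\<^sup>2 + ((q - p) \<bullet> (r - p))\<^sup>2 = A * B"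
    unfolding A_def B_def by (rule cross2_sq)
  ultimately have "4 * (cross2 (q - p) (r - p))\<^sup>2 = 4 * A * B - (A + B - C)\<^sup>2"
    by linarith
  also have "\<dots> \<le> 3 * (h\<^sup>2)\<^sup>2"
  proof -
    define H where "H = h\<^sup>2"
    \<comment> \<open>In terms of the deficits from \<open>H\<close> the formula is 3
      \<open>H\<close> squared minus visibly nonnegative terms, because each deficit lies between 0
      and \<open>H\<close>.\<close>
    define a b c where "a = H - A" and "b = H - B" and "c = H - C"
    have nn: "0 \<le> a" "0 \<le> b" "0 \<le> c" "a \<le> H" "b \<le> H" "c \<le> H"
      using le unfolding a_def b_def c_def H_def by (simp_all add: A_def B_def C_def)
    have le': "a * b + b * c + c * a \<le> a * H + b * H + c * H"
      using nn by (intro add_mono mult_left_mono) auto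
    have "4 * (H - a) * (H - b) - ((H - a) + (H - b) - (H - c))\<^sup>2
        = 3 * H\<^sup>2 - 2 * ((a * H + b * H + c * H) - (a * b + b * c + c * a)) - (a\<^sup>2 + b\<^sup>2 + c\<^sup>2)"
      by (simp add: power2_eq_square algebra_simps)
    also have "\<dots> \<le> 3 * H\<^sup>2 - 2 * 0 - 0"
      using le' by (intro diff_mono mult_left_mono) auto
    finally have "4 * (H - a) * (H - b) - ((H - a) + (H - b) - (H - c))\<^sup>2 \<le> 3 * H\<^sup>2"
      by simp
    then show ?thesis by (simp add: a_def b_def c_def H_def)
  qed
  finally have "(2 * \<bar>cross2 (q - p) (r - p)\<bar>)\<^sup>2 \<le> (sqrt 3 * h\<^sup>2)\<^sup>2"
    by (simp add: power_mult_distrib)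
  then have "2 * \<bar>cross2 (q - p) (r - p)\<bar> \<le> sqrt 3 * h\<^sup>2"
    by (rule power2_le_imp_le) simp
  then show ?thesis by (simp add: content_triangle_cross2)
qed

text \<open>The inner product is \<open>\<bar>cross2 u w\<bar>\<close> times the cotangent of the
  enclosed angle, and the cotangent decreases on (0, \<pi>).\<close>

lemma inner_le_cross2_cot:
  assumes "cross2 u w \<noteq> 0" "0 < \<omega>" "\<omega> \<le> vangle u w"
  shows "u \<bullet> w \<le> \<bar>cross2 u w\<bar> * cot \<omega>"
proof -
  define n where "n = norm u * norm w"
  define t where "t = (u \<bullet> w) / n"
  have "u \<noteq> 0" "w \<noteq> 0" using assms(1) by (auto simp: cross2_def)
  then have n: "0 < n" by (simp add: n_def)
  have sq: "(cross2 u w)\<^sup>2 + (u \<bullet> w)\<^sup>2 = n\<^sup>2" unfolding cross2_sq by (simp add: n_def power_mult_distrib)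
  then have "1 - t\<^sup>2 = (cross2 u w)\<^sup>2 / n\<^sup>2"
    using n by (simp add: t_def power_divide field_simps)
  then have sq1: "1 - t\<^sup>2 = (\<bar>cross2 u w\<bar> / n)\<^sup>2" by (simp add: power_divide)
  also have "\<dots> > 0" using assms(1) n by simp
  finally have "\<bar>t\<bar> < 1" by (simp add: abs_square_less_1)
  then have t: "-1 < t" "t < 1" by auto
  define \<alpha> where "\<alpha> = vangle u w"
  have \<alpha>: "\<alpha> = arccos t" by (simp add: \<alpha>_def vangle_def t_def n_def)
  have "\<alpha> < pi" using arccos_lt_bounded[OF t] \<alpha> by simp
  have "cos \<alpha> = t" using t \<alpha> by simp
  have "sin \<alpha> = sqrt (1 - t\<^sup>2)" using t \<alpha> by (simp add: sin_arccos)
  also have "\<dots> = \<bar>cross2 u w\<bar> / n" unfolding sq1 using n by (simp add: real_sqrt_abs)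
  finally have sin\<alpha>: "sin \<alpha> = \<bar>cross2 u w\<bar> / n" .
  \<comment> \<open>Monotonicity of the cotangent in multiplied form; the sign of the cosine does
    not enter, so obtuse angles are covered.\<close>
  have "0 \<le> sin (\<alpha> - \<omega>)" using assms \<open>\<alpha> < pi\<close> by (intro sin_ge_zero) (auto simp: \<alpha>_def)
  then have "t * sin \<omega> \<le> \<bar>cross2 u w\<bar> / n * cos \<omega>"
    using \<open>cos \<alpha> = t\<close> sin\<alpha> by (simp add: sin_diff)
  then have "(u \<bullet> w) * sin \<omega> \<le> \<bar>cross2 u w\<bar> * cos \<omega>"
    using n by (simp add: t_def field_simps)
  moreover have "0 < sin \<omega>" using assms \<open>\<alpha> < pi\<close> by (intro sin_gt_zero) (auto simp: \<alpha>_def)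
  ultimately show ?thesis by (simp add: cot_def field_simps)
qed

text \<open>The squared sides add up to twice the inner products at the three vertices. The constant
  12 is 2 * 3 * 2, the last factor because \<open>cross2\<close> is twice the area.\<close>

lemma sum_sq_sides_le_cot:
  assumes D: "cross2 (q - p) (r - p) \<noteq> 0" and "0 < \<omega>"
    and "\<omega> \<le> vangle (q - p) (r - p)" "\<omega> \<le> vangle (r - q) (p - q)" "\<omega> \<le> vangle (p - r) (q - r)"
  shows "(norm (q - p))\<^sup>2 + (norm (r - p))\<^sup>2 + (norm (r - q))\<^sup>2
    \<le> 12 * measure lborel (convex hull {p, q, r}) * cot \<omega>"
proof -
  have e: "cross2 (r - q) (p - q) = cross2 (q - p) (r - p)" "cross2 (p - r) (q - r) = cross2 (q - p) (r - p)"
    using cross2_rotate[of r q p] cross2_rotate[of p r q] by simp_all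
  have "(norm (q - p))\<^sup>2 + (norm (r - p))\<^sup>2 + (norm (r - q))\<^sup>2
     = 2 * ((q - p) \<bullet> (r - p) + (r - q) \<bullet> (p - q) + (p - r) \<bullet> (q - r))"
    unfolding power2_norm_eq_inner by (simp add: inner_diff_left inner_diff_right inner_commute algebra_simps)
  also have "\<dots> \<le> 2 * (3 * (\<bar>cross2 (q - p) (r - p)\<bar> * cot \<omega>))"
    using inner_le_cross2_cot[of "q - p" "r - p" \<omega>] inner_le_cross2_cot[of "r - q" "p - q" \<omega>]
      inner_le_cross2_cot[of "p - r" "q - r" \<omega>] assms unfolding e by simp
  finally show ?thesis by (simp add: content_triangle_cross2)
qed

lemma agrad_eq:
  assumes "affine_fun f"
  shows "f y - f x = agrad f \<bullet> (y - x)"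
proof -
  have "\<exists>c. \<forall>x. f x = agrad f \<bullet> x + c"
    using assms unfolding affine_fun_def agrad_def by (rule someI_ex)
  then show ?thesis by (auto simp: inner_diff_right)
qed

subsection \<open>The approximation estimate\<close>

text \<open>Open half-lines are convex. This turns the hull condition on the nodal value into the
  two signs needed on a cycle.\<close>

lemma convex_hull_real_straddle:
  fixes f :: "'a \<Rightarrow> real"
  assumes "x \<in> convex hull {f T | T. T \<in> A}"
  obtains T1 T2 where "T1 \<in> A" "f T1 \<le> x" "T2 \<in> A" "x \<le> f T2"
proof -
  have "\<exists>T\<in>A. f T \<le> x"
  proof (rule ccontr)
    assume "\<not> ?thesis"
    then have "convex hull {f T | T. T \<in> A} \<subseteq> {x<..}" by (intro hull_minimal) force+
    then show False using assms by auto
  qed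
  moreover have "\<exists>T\<in>A. x \<le> f T"
  proof (rule ccontr)
    assume "\<not> ?thesis"
    then have "convex hull {f T | T. T \<in> A} \<subseteq> {..<x}" by (intro hull_minimal) force+
    then show False using assms by auto
  qed
  ultimately show ?thesis using that by blast
qed

context lipschitz_triangulation
begin

lemma nodes_finite: "finite (nodes \<T>)"
  using finite_triangulation finite_vertices by (auto simp: nodes_def)

lemma card_tri_at_le_M_patch: "z \<in> nodes \<T> \<Longrightarrow> card (tri_at \<T> z) \<le> M_patch \<T>"
  unfolding M_patch_def using nodes_finite by (intro Max_ge) auto

lemma M_patch_pos: "0 < M_patch \<T>"
proof -
  obtain T where T: "T \<in> \<T>" using tri by (auto simp: regular_triangulation_def)
  then obtain z where "z \<in> T" using is_triangle[OF T] by (fastforce simp: is_triangle_def)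
  then have "T \<in> tri_at \<T> z" "z \<in> nodes \<T>" using T by (auto simp: tri_at_iff nodes_def)
  then have "0 < card (tri_at \<T> z)" using finite_tri_at card_gt_0_iff by blast
  then show ?thesis using card_tri_at_le_M_patch[OF \<open>z \<in> nodes \<T>\<close>] by simp
qed

lemma cos_M_patch: "0 < 1 - cos (pi / real (M_patch \<T>))"
proof -
  have "pi / real (M_patch \<T>) \<le> pi / 1"
    using M_patch_pos by (intro divide_left_mono) auto
  moreover have "0 < pi / real (M_patch \<T>)" using M_patch_pos by simp
  ultimately have "cos (pi / real (M_patch \<T>)) < cos 0" by (intro cos_monotone_0_pi) auto
  then show ?thesis by simp
qed

lemma node_estimate:
  assumes v: "v \<in> CR10 \<Omega> \<T>" and u: "u \<in> S10 \<Omega> \<T>" and z: "z \<in> nodes \<T>"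
    and conv: "z \<in> \<Omega> \<Longrightarrow> u z \<in> convex hull {v T z | T. T \<in> tri_at \<T> z}"
  shows "2 * (1 - cos (pi / real (M_patch \<T>))) * (\<Sum>T\<in>tri_at \<T> z. (v T z - u z)\<^sup>2)
    \<le> (\<Sum>T\<in>tri_at \<T> z. \<Sum>a\<in>T - {z}. (agrad (v T) \<bullet> (a - z))\<^sup>2) / 2"
proof -
  \<comment> \<open>Half the increment, since the midpoint is half way; its square turns the factor
    2 of the abstract estimates into 1 / 2.\<close>
  define d where "d = (\<lambda>T a. agrad (v T) \<bullet> (a - z) / 2)"
  have aff: "affine_fun (v T)" if "T \<in> \<T>" for T using v that by (simp add: CR10_def)
  have mid: "v T z - u z + d T a = v T (midpoint z a) - u z" if "T \<in> \<T>" for T a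
    using agrad_eq[OF aff[OF that], of a z] affine_fun_midpoint[OF aff[OF that], of z a]
    by (simp add: d_def field_simps)
  have match: "v T z - u z + d T a = v T' z - u z + d T' a"
    if *: "T \<in> tri_at \<T> z" "T' \<in> tri_at \<T> z" "a \<in> T" "a \<in> T'" "a \<noteq> z" for T T' a
  proof (cases "T = T'")
    case False
    have **: "T \<in> \<T>" "T' \<in> \<T>" "{z, a} \<subseteq> T" "{z, a} \<subseteq> T'" "z \<noteq> a"
      using * by (auto simp: tri_at_iff)
    have "midpoint z a \<in> open_segment z a" using **(5) by simp
    then have "midpoint z a \<in> \<Omega>" using open_edge_in_domain[OF **(1,2) False **(5,3,4)] by blast
    then have "v T (midpoint z a) = v T' (midpoint z a)" using v ** unfolding CR10_def by blast
    then show ?thesis using mid ** by simp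
  qed simp
  have "2 * (1 - cos (pi / real (M_patch \<T>))) * (\<Sum>T\<in>tri_at \<T> z. (v T z - u z)\<^sup>2)
    \<le> 2 * (\<Sum>T\<in>tri_at \<T> z. \<Sum>a\<in>T - {z}. (d T a)\<^sup>2)"
  proof (cases "z \<in> \<Omega>")
    case True
    obtain T1 T2 where T: "T1 \<in> tri_at \<T> z" "v T1 z \<le> u z" "T2 \<in> tri_at \<T> z" "u z \<le> v T2 z"
      using convex_hull_real_straddle[OF conv[OF True]] by blast
    show ?thesis
    proof (rule interior_node_estimate[OF True _ card_tri_at_le_M_patch[OF z], of "\<lambda>T. v T z - u z" d T1 T2])
      show "v T z - u z + d T a = v T' z - u z + d T' a"
        if "T \<in> tri_at \<T> z" "T' \<in> tri_at \<T> z" "a \<in> T" "a \<in> T'" "a \<noteq> z" for T T' a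
        using that by (rule match)
    qed (use T in auto)
  next
    case False
    show ?thesis
    proof (rule boundary_node_estimate[OF False card_tri_at_le_M_patch[OF z], of "\<lambda>T. v T z - u z" d])
      show "v T z - u z + d T a = v T' z - u z + d T' a"
        if "T \<in> tri_at \<T> z" "T' \<in> tri_at \<T> z" "a \<in> T" "a \<in> T'" "a \<noteq> z" for T T' a
        using that by (rule match)
      fix T a assume *: "T \<in> tri_at \<T> z" "a \<in> T" "a \<noteq> z"
        "\<And>T'. T' \<in> tri_at \<T> z \<Longrightarrow> a \<in> T' \<Longrightarrow> T' = T"
      have T: "T \<in> \<T>" "{z, a} \<subseteq> T" "z \<noteq> a" using *(1-3) by (auto simp: tri_at_iff)
      \<comment> \<open>Both terms of the boundary condition are zero: \<open>u\<close> vanishes at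
        the boundary node, and an edge with a single triangle has its midpoint on the boundary,
        where \<open>v T\<close> vanishes.\<close>
      have "z \<in> closure \<Omega>" using triangle_subset_closure[OF T(1)] hull_inc[of z T convex] T by blast
      then have "z \<in> frontier \<Omega>" using False dom by (simp add: frontier_def interior_open lipschitz_domain_def)
      then have "u z = 0" using u by (simp add: S10_def)
      moreover have "midpoint z a \<in> frontier \<Omega>"
        unfolding edge_midpoint_cases[OF T(1,3,2)] using *(4) unfolding tri_at_iff by blast
      then have "v T (midpoint z a) = 0" using v T unfolding CR10_def by blast
      ultimately show "v T z - u z + d T a = 0" using mid[OF T(1)] by simp
    qed
  qed
  also have "\<dots> = (\<Sum>T\<in>tri_at \<T> z. \<Sum>a\<in>T - {z}. (agrad (v T) \<bullet> (a - z))\<^sup>2) / 2"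
    unfolding sum_divide_distrib sum_distrib_left
    by (intro sum.cong refl) (simp add: d_def power_divide)
  finally show ?thesis .
qed

text \<open>Cauchy-Schwarz on each edge. Every side is counted from both endpoints, which doubles
  the 12 of the side bound.\<close>

lemma angle_bound_trace:
  assumes T: "T \<in> \<T>" and "0 < \<omega>" and angles: "min_angle_bound \<T> \<omega>"
  shows "(\<Sum>z\<in>T. \<Sum>a\<in>T - {z}. (g \<bullet> (a - z))\<^sup>2)
    \<le> 24 * cot \<omega> * integral (convex hull T) (\<lambda>x. (norm g)\<^sup>2)"
proof -
  obtain p where "p \<in> T" using is_triangle[OF T] by (fastforce simp: is_triangle_def)
  then obtain q r where qr: "T = {p, q, r}" "p \<noteq> q" "p \<noteq> r" "q \<noteq> r" "cross2 (q - p) (r - p) \<noteq> 0"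
    using is_triangleE[OF is_triangle[OF T]] by metis
  have ang: "\<omega> \<le> vangle (b - a) (c - a)"
    if "a \<in> T" "b \<in> T" "c \<in> T" "a \<noteq> b" "a \<noteq> c" "b \<noteq> c" for a b c
    using angles T that unfolding min_angle_bound_def by blast
  have sides: "(norm (q - p))\<^sup>2 + (norm (r - p))\<^sup>2 + (norm (r - q))\<^sup>2
    \<le> 12 * measure lborel (convex hull {p, q, r}) * cot \<omega>"
    by (rule sum_sq_sides_le_cot) (use qr assms ang in auto)
  have CS: "(g \<bullet> w)\<^sup>2 \<le> (norm g)\<^sup>2 * (norm w)\<^sup>2" for w
    using Cauchy_Schwarz_ineq[of g w] by (simp add: power2_norm_eq_inner)
  have sym: "(g \<bullet> (a - b))\<^sup>2 = (g \<bullet> (b - a))\<^sup>2" for a b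
    by (simp add: inner_diff_right power2_commute)
  have "{p, q, r} - {p} = {q, r}" "{p, q, r} - {q} = {p, r}" "{p, q, r} - {r} = {p, q}"
    using qr by auto
  then have "(\<Sum>z\<in>T. \<Sum>a\<in>T - {z}. (g \<bullet> (a - z))\<^sup>2)
     = 2 * ((g \<bullet> (q - p))\<^sup>2 + (g \<bullet> (r - p))\<^sup>2 + (g \<bullet> (r - q))\<^sup>2)"
    unfolding qr(1) using qr sym[of p q] sym[of p r] sym[of q r] by simp
  also have "\<dots> \<le> 2 * ((norm g)\<^sup>2 * ((norm (q - p))\<^sup>2 + (norm (r - p))\<^sup>2 + (norm (r - q))\<^sup>2))"
    unfolding distrib_left[of "(norm g)\<^sup>2"] by (intro mult_left_mono add_mono CS) simp
  also have "\<dots> \<le> 2 * ((norm g)\<^sup>2 * (12 * measure lborel (convex hull {p, q, r}) * cot \<omega>))"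
    using sides by (intro mult_left_mono) auto
  also have "\<dots> = 24 * cot \<omega> * integral (convex hull T) (\<lambda>x. (norm g)\<^sup>2)"
    unfolding qr(1) integral_triangle_const by simp
  finally show ?thesis .
qed

text \<open>The constant is sqrt 3 / 4 from the area times 1 / 3 from the vertex bound; the diameter
  cancels.\<close>

lemma element_error_le:
  assumes v: "v \<in> CR10 \<Omega> \<T>" and u: "u \<in> S10 \<Omega> \<T>" and T: "T \<in> \<T>"
  shows "integral (convex hull T) (\<lambda>x. ((v T x - u x) / hT T)\<^sup>2) \<le> sqrt 3 / 12 * (\<Sum>z\<in>T. (v T z - u z)\<^sup>2)"
proof -
  obtain p where "p \<in> T" using is_triangle[OF T] by (fastforce simp: is_triangle_def)
  then obtain q r where qr: "T = {p, q, r}" "p \<noteq> q" "p \<noteq> r" "q \<noteq> r" "cross2 (q - p) (r - p) \<noteq> 0"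
    using is_triangleE[OF is_triangle[OF T]] by metis
  obtain g where g: "affine_fun g" "\<And>x. x \<in> convex hull T \<Longrightarrow> u x = g x"
    using u T unfolding S10_def by blast
  have "affine_fun (v T)" using v T by (simp add: CR10_def)
  then obtain b c b' c' where bc: "\<And>x. v T x = b \<bullet> x + c" "\<And>x. g x = b' \<bullet> x + c'"
    using g(1) unfolding affine_fun_def by blast
  define h where "h = hT T"
  \<comment> \<open>On the triangle \<open>u\<close> is replaced by its affine piece, so the scaled
    error becomes affine on the whole plane.\<close>
  define f where "f = (\<lambda>x. (v T x - g x) / h)"
  have "f x = ((1 / h) *\<^sub>R (b - b')) \<bullet> x + (c - c') / h" for x
    unfolding f_def bc by (simp add: inner_diff_left diff_divide_distrib add_divide_distrib)
  then have f: "affine_fun f" unfolding affine_fun_def by blast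
  have bdd: "bounded (convex hull T)"
    using finite_vertices[OF T] by (simp add: finite_imp_bounded_convex_hull)
  have side: "norm (b - a) \<le> h" if "a \<in> T" "b \<in> T" for a b
    using diameter_bounded_bound[OF bdd, of b a] that hull_inc[of _ T convex]
    by (simp add: h_def hT_def dist_norm)
  have "0 < norm (q - p)" using qr by simp
  also have "\<dots> \<le> h" using side qr by auto
  finally have h: "0 < h" .
  have area: "measure lborel (convex hull {p, q, r}) \<le> sqrt 3 / 4 * h\<^sup>2"
    by (rule content_triangle_le_diameter) (use side qr in auto)
  have uT: "u z = g z" if "z \<in> T" for z using g(2) hull_inc[of z T convex] that by blast
  have "integral (convex hull T) (\<lambda>x. ((v T x - u x) / hT T)\<^sup>2) = integral (convex hull T) (\<lambda>x. (f x)\<^sup>2)"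
    by (rule integral_cong) (simp add: f_def g(2) h_def)
  also have "\<dots> \<le> measure lborel (convex hull {p, q, r}) / 3 * ((f p)\<^sup>2 + (f q)\<^sup>2 + (f r)\<^sup>2)"
    unfolding qr(1) by (rule integral_affine_sq_triangle_le[OF qr(5) f])
  also have "\<dots> \<le> (sqrt 3 / 4 * h\<^sup>2) / 3 * ((f p)\<^sup>2 + (f q)\<^sup>2 + (f r)\<^sup>2)"
    using area by (intro mult_right_mono divide_right_mono) auto
  also have "\<dots> = sqrt 3 / 12 * ((v T p - g p)\<^sup>2 + (v T q - g q)\<^sup>2 + (v T r - g r)\<^sup>2)"
    using h by (simp add: f_def power_divide add_divide_distrib[symmetric])
  also have "(v T p - g p)\<^sup>2 + (v T q - g q)\<^sup>2 + (v T r - g r)\<^sup>2 = (\<Sum>z\<in>T. (v T z - u z)\<^sup>2)"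
    using uT qr(2-4) by (simp add: qr(1))
  finally show ?thesis .
qed

text \<open>Common core of both bounds: \<open>Z\<close> are the nodes that carry the error,
  \<open>K\<close> the triangles whose gradients may be used.\<close>

lemma patch_estimate:
  assumes v: "v \<in> CR10 \<Omega> \<T>" and u: "u \<in> S10 \<Omega> \<T>"
    and conv: "\<And>z. z \<in> nodes \<T> \<Longrightarrow> z \<in> \<Omega> \<Longrightarrow> u z \<in> convex hull {v T z | T. T \<in> tri_at \<T> z}"
    and \<omega>: "0 < \<omega>" "min_angle_bound \<T> \<omega>"
    and Z: "Z \<subseteq> nodes \<T>" and K: "K \<subseteq> \<T>" "\<And>T. T \<in> \<T> \<Longrightarrow> T \<inter> Z \<noteq> {} \<Longrightarrow> T \<in> K"
    and X: "X \<le> sqrt 3 / 12 * (\<Sum>z\<in>Z. \<Sum>T\<in>tri_at \<T> z. (v T z - u z)\<^sup>2)"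
  shows "sqrt X \<le> sqrt ((sqrt 3 / 2) * cot \<omega> / (1 - cos (pi / real (M_patch \<T>))))
    * sqrt (\<Sum>T\<in>K. integral (convex hull T) (\<lambda>x. (norm (agrad (v T)))\<^sup>2))"
proof -
  define \<kappa> where "\<kappa> = 1 - cos (pi / real (M_patch \<T>))"
  define S where "S = (\<Sum>z\<in>Z. \<Sum>T\<in>tri_at \<T> z. (v T z - u z)\<^sup>2)"
  define R where "R = (\<Sum>T\<in>K. integral (convex hull T) (\<lambda>x. (norm (agrad (v T)))\<^sup>2))"
  define Q where "Q = (\<lambda>T z. \<Sum>a\<in>T - {z}. (agrad (v T) \<bullet> (a - z))\<^sup>2)"
  have Q: "0 \<le> Q T z" for T z by (simp add: Q_def sum_nonneg)
  have finZ: "finite Z" using Z nodes_finite finite_subset by blast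
  have finK: "finite K" using K(1) finite_triangulation finite_subset by blast
  have \<kappa>: "0 < \<kappa>" using cos_M_patch by (simp add: \<kappa>_def)
  have "2 * \<kappa> * S = (\<Sum>z\<in>Z. 2 * \<kappa> * (\<Sum>T\<in>tri_at \<T> z. (v T z - u z)\<^sup>2))"
    unfolding S_def by (rule sum_distrib_left)
  also have "\<dots> \<le> (\<Sum>z\<in>Z. (\<Sum>T\<in>tri_at \<T> z. Q T z) / 2)"
    unfolding \<kappa>_def Q_def using Z conv by (intro sum_mono node_estimate[OF v u]) auto
  also have "\<dots> = (\<Sum>z\<in>Z. \<Sum>T | T \<in> \<T> \<and> z \<in> T. Q T z) / 2"
    by (simp add: sum_divide_distrib tri_at_def)
  also have "(\<Sum>z\<in>Z. \<Sum>T | T \<in> \<T> \<and> z \<in> T. Q T z) = (\<Sum>T\<in>\<T>. \<Sum>z | z \<in> Z \<and> z \<in> T. Q T z)"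
    by (rule sum.swap_restrict[OF finZ finite_triangulation])
  also have "\<dots> = (\<Sum>T\<in>K. \<Sum>z | z \<in> Z \<and> z \<in> T. Q T z)"
  proof (rule sum.mono_neutral_right[OF finite_triangulation K(1)], rule ballI)
    fix T assume "T \<in> \<T> - K"
    then have "{z. z \<in> Z \<and> z \<in> T} = {}" using K(2) by blast
    then show "(\<Sum>z | z \<in> Z \<and> z \<in> T. Q T z) = 0" by (simp only: sum.empty)
  qed
  \<comment> \<open>After the exchange of sums a triangle is charged only by its vertices in
    \<open>Z\<close>; nonnegativity allows all three to be included.\<close>
  also have "\<dots> / 2 \<le> (\<Sum>T\<in>K. \<Sum>z\<in>T. Q T z) / 2"
    using Q K finite_vertices by (intro divide_right_mono sum_mono sum_mono2) auto
  also have "\<dots> \<le> (\<Sum>T\<in>K. 24 * cot \<omega> * integral (convex hull T) (\<lambda>x. (norm (agrad (v T)))\<^sup>2)) / 2"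
    unfolding Q_def using K \<omega> by (intro divide_right_mono sum_mono angle_bound_trace) auto
  also have "\<dots> = 12 * cot \<omega> * R"
    unfolding R_def sum_distrib_left[symmetric] by simp
  finally have "S \<le> 6 * cot \<omega> * R / \<kappa>"
    using \<kappa> by (simp add: field_simps)
  then have "sqrt 3 / 12 * S \<le> sqrt 3 / 12 * (6 * cot \<omega> * R / \<kappa>)"
    by (intro mult_left_mono) auto
  also have "\<dots> = sqrt 3 / 2 * cot \<omega> / \<kappa> * R" by simp
  finally have "X \<le> sqrt 3 / 2 * cot \<omega> / \<kappa> * R"
    using X unfolding S_def by (rule order_trans[rotated])
  then have "sqrt X \<le> sqrt (sqrt 3 / 2 * cot \<omega> / \<kappa> * R)" by (rule real_sqrt_le_mono)
  also have "\<dots> = sqrt (sqrt 3 / 2 * cot \<omega> / \<kappa>) * sqrt R" by (rule real_sqrt_mult)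
  finally show ?thesis unfolding \<kappa>_def R_def .
qed

end

section \<open>Global and local error bounds\<close>

theorem theorem4p2:
  fixes \<Omega> :: "pt set" and \<T> :: "pt set set" and \<omega>0 :: real
    and JC :: "(pt set \<Rightarrow> pt \<Rightarrow> real) \<Rightarrow> pt \<Rightarrow> real"
  assumes dom: "lipschitz_domain \<Omega>"
    and tri: "regular_triangulation \<Omega> \<T>"
    and om0: "\<omega>0 > 0" and angles: "min_angle_bound \<T> \<omega>0"
    and JS: "\<And>v. v \<in> CR10 \<Omega> \<T> \<Longrightarrow> JC v \<in> S10 \<Omega> \<T>"
    and Jconv: "\<And>v z. v \<in> CR10 \<Omega> \<T> \<Longrightarrow> z \<in> nodes \<T> \<Longrightarrow> z \<in> \<Omega> \<Longrightarrow>
                   JC v z \<in> convex hull {v T z | T. T \<in> tri_at \<T> z}"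
  shows "\<forall>v\<in>CR10 \<Omega> \<T>.
     (let c_apx = sqrt ((sqrt 3 / 2) * cot \<omega>0 / (1 - cos (pi / real (M_patch \<T>)))) in
      sqrt (\<Sum>T\<in>\<T>. integral (convex hull T) (\<lambda>x. ((v T x - JC v x) / hT T)\<^sup>2))
        \<le> c_apx * sqrt (\<Sum>T\<in>\<T>. integral (convex hull T) (\<lambda>x. (norm (agrad (v T)))\<^sup>2))
      \<and> (\<forall>T\<in>\<T>.
          sqrt (integral (convex hull T) (\<lambda>x. ((v T x - JC v x) / hT T)\<^sup>2))
            \<le> c_apx * sqrt (\<Sum>T'\<in>{T'\<in>\<T>. convex hull T' \<subseteq> elem_patch \<T> T}.
                   integral (convex hull T') (\<lambda>x. (norm (agrad (v T')))\<^sup>2))))"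
proof -
  interpret lipschitz_triangulation \<Omega> \<T> by unfold_locales (fact dom, fact tri)
  show ?thesis
    unfolding Let_def
  proof (intro ballI conjI)
    fix v assume v: "v \<in> CR10 \<Omega> \<T>"
    show "sqrt (\<Sum>T\<in>\<T>. integral (convex hull T) (\<lambda>x. ((v T x - JC v x) / hT T)\<^sup>2))
        \<le> sqrt ((sqrt 3 / 2) * cot \<omega>0 / (1 - cos (pi / real (M_patch \<T>))))
          * sqrt (\<Sum>T\<in>\<T>. integral (convex hull T) (\<lambda>x. (norm (agrad (v T)))\<^sup>2))"
    proof (rule patch_estimate[OF v JS[OF v] Jconv[OF v] om0 angles subset_refl subset_refl])
      have "(\<Sum>T\<in>\<T>. integral (convex hull T) (\<lambda>x. ((v T x - JC v x) / hT T)\<^sup>2))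
        \<le> (\<Sum>T\<in>\<T>. sqrt 3 / 12 * (\<Sum>z\<in>T. (v T z - JC v z)\<^sup>2))"
        by (intro sum_mono element_error_le v JS)
      also have "\<dots> = sqrt 3 / 12 * (\<Sum>T\<in>\<T>. \<Sum>z | z \<in> nodes \<T> \<and> z \<in> T. (v T z - JC v z)\<^sup>2)"
        unfolding sum_distrib_left[symmetric]
        by (intro arg_cong2[where f = "(*)"] sum.cong) (auto simp: nodes_def)
      also have "(\<Sum>T\<in>\<T>. \<Sum>z | z \<in> nodes \<T> \<and> z \<in> T. (v T z - JC v z)\<^sup>2)
         = (\<Sum>z\<in>nodes \<T>. \<Sum>T | T \<in> \<T> \<and> z \<in> T. (v T z - JC v z)\<^sup>2)"
        by (rule sum.swap_restrict[OF finite_triangulation nodes_finite])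
      finally show "(\<Sum>T\<in>\<T>. integral (convex hull T) (\<lambda>x. ((v T x - JC v x) / hT T)\<^sup>2))
        \<le> sqrt 3 / 12 * (\<Sum>z\<in>nodes \<T>. \<Sum>T\<in>tri_at \<T> z. (v T z - JC v z)\<^sup>2)"
        by (simp add: tri_at_def)
    qed
  next
    fix v T assume v: "v \<in> CR10 \<Omega> \<T>" and T: "T \<in> \<T>"
    show "sqrt (integral (convex hull T) (\<lambda>x. ((v T x - JC v x) / hT T)\<^sup>2))
        \<le> sqrt ((sqrt 3 / 2) * cot \<omega>0 / (1 - cos (pi / real (M_patch \<T>))))
          * sqrt (\<Sum>T'\<in>{T'\<in>\<T>. convex hull T' \<subseteq> elem_patch \<T> T}.
                   integral (convex hull T') (\<lambda>x. (norm (agrad (v T')))\<^sup>2))"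
    \<comment> \<open>A triangle is its vertex set, so \<open>T\<close> itself serves as the set of
      nodes. The value from \<open>T\<close> is one summand of each nodal sum over the star.\<close>
    proof (rule patch_estimate[OF v JS[OF v] Jconv[OF v] om0 angles, where Z = T])
      show "T \<subseteq> nodes \<T>" using T by (auto simp: nodes_def)
      show "T' \<in> {T' \<in> \<T>. convex hull T' \<subseteq> elem_patch \<T> T}" if "T' \<in> \<T>" "T' \<inter> T \<noteq> {}" for T'
        using that unfolding elem_patch_def node_patch_def tri_at_def by blast
      have "(v T z - JC v z)\<^sup>2 \<le> (\<Sum>T'\<in>tri_at \<T> z. (v T' z - JC v z)\<^sup>2)" if "z \<in> T" for z
        using T that finite_tri_at by (intro member_le_sum) (auto simp: tri_at_iff)
      then have "sqrt 3 / 12 * (\<Sum>z\<in>T. (v T z - JC v z)\<^sup>2)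
        \<le> sqrt 3 / 12 * (\<Sum>z\<in>T. \<Sum>T'\<in>tri_at \<T> z. (v T' z - JC v z)\<^sup>2)"
        by (intro mult_left_mono sum_mono) auto
      then show "integral (convex hull T) (\<lambda>x. ((v T x - JC v x) / hT T)\<^sup>2)
        \<le> sqrt 3 / 12 * (\<Sum>z\<in>T. \<Sum>T'\<in>tri_at \<T> z. (v T' z - JC v z)\<^sup>2)"
        using element_error_le[OF v JS[OF v] T] by linarith
    qed auto
  qed
qed

end
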